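(* Let $X$ be a metric space, let $\mu$ be a measure over $X$, let $\mathcal S\subset\mathcal P(X)$ be a nonempty class and let $\zeta:\mathcal S\to[0,+\infty]$ be a gauge. Fix $\tau>1$ and a nonempty set $A\subset X$, and assume: (1) $\mu$ is a Borel regular measure. (2) Every element of $\mathcal S$ is Borel and every element of $\mathcal S_{\mu,\zeta}$ is closed. (3) $\mathcal S_{\mu,\zeta}$ covers $A$ finely. (4) $A$ is $\psi_\zeta$-measurable and $\sigma$-finite with respect to $\psi_\zeta$. (5) $A$ has a countable covering whose elements are open and have finite $\mu$-measure. (6) There exist $c\ge1$ and $\eta>0$ such that for every $S\in\mathcal S_{\mu,\zeta}$ there exists $\tilde S\in\mathcal S$ with $\hat S\subset\tilde S$, $\operatorname{diam}(\tilde S)\le c\,\operatorname{diam}(S)$ and $\zeta(\tilde S)\le\eta\,\zeta(S)$. (7) $\mu\llcorner A\ll\psi_\zeta\llcorner A$. If $F^\zeta(\mu,\cdot):A\to[0,+\infty]$ is $\psi_\zeta$-measurable, then every $\psi_\zeta$-measurable subset $B\subset A$ is also $\mu$-measurable and $$\mu(B)=\int_B F^\zeta(\mu,x)\,d\psi_\zeta(x).$$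
   Context: $X$ is a metric space with distance $d$. A "measure over $X$" is an outer measure defined on all subsets of $X$; measurability is in the sense of Carathéodory, and integrals are with respect to the restriction of the outer measure to its measurable sets. A measure $\mu$ over $X$ is Borel regular if all Borel sets are $\mu$-measurable and every $E\subset X$ is contained in a Borel set $E'$ with $\mu(E')=\mu(E)$. A set is $\sigma$-finite with respect to a measure over $X$ if it is covered by countably many sets of finite measure. $(\mu\llcorner A)(E)=\mu(A\cap E)$, and $\mu\llcorner A\ll\psi\llcorner A$ means that $\mu(N)=0$ for every $N\subset A$ with $\psi(N)=0$. A gauge is a function $\zeta:\mathcal S\to[0,+\infty]$ on a nonempty class $\mathcal S\subset\mathcal P(X)$. Convention: $\operatorname{diam}(\emptyset)=0$. Carathéodory measure: for $\delta>0$ and $R\subset X$, $\phi_{\zeta,\delta}(R)=\inf\sum_j\zeta(E_j)$, the infimum being over all countable (possibly finite) families $\{E_j\}\subset\mathcal S$ covering $R$ with $\operatorname{diam}(E_j)\le\delta$ for all $j$ ($\inf\emptyset=+\infty$); $\psi_\zeta(R)=\sup_{\delta>0}\phi_{\zeta,\delta}(R)$. A family $\mathcal G\subset\mathcal P(X)$ covers $A$ finely if for every $a\in A$ and $\epsilon>0$ there is $S\in\mathcal G$ with $a\in S$ and $\operatorname{diam}(S)<\epsilon$. $\mathcal S_{\mu,\zeta}=\mathcal S\setminus\{S\in\mathcal S:\ \zeta(S)=\mu(S)=0\ \text{or}\ \mu(S)=\zeta(S)=+\infty\}$. The quotient function $Q_{\mu,\zeta}:\mathcal S_{\mu,\zeta}\to[0,+\infty]$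 is $Q_{\mu,\zeta}(S)=+\infty$ if $\zeta(S)=0$, $Q_{\mu,\zeta}(S)=\mu(S)/\zeta(S)$ if $0<\zeta(S)<+\infty$, and $Q_{\mu,\zeta}(S)=0$ if $\zeta(S)=+\infty$. If for every $\epsilon>0$ some $S\in\mathcal S_{\mu,\zeta}$ satisfies $x\in S$ and $\operatorname{diam}(S)<\epsilon$, the Federer density of $\mu$ at $x$ is $$F^\zeta(\mu,x)=\inf_{\epsilon>0}\sup\{Q_{\mu,\zeta}(S): S\in\mathcal S_{\mu,\zeta},\ x\in S,\ \operatorname{diam}(S)<\epsilon\}.$$ For the fixed $\tau>1$, the enlargement of $S$ is $\hat S=\bigcup\{T\in\mathcal S_{\mu,\zeta}: T\cap S\neq\emptyset,\ \operatorname{diam}(T)\le\tau\operatorname{diam}(S)\}$. *)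

theory Defs
  imports "HOL-Analysis.Analysis"
begin

section \<open>Outer measures defined on all subsets of a type\<close>

text \<open>A ``measure over X'' is an outer measure defined on every subset of \<open>X\<close>; the metric
  space \<open>X\<close> is the carrier of a type of class \<^class>\<open>metric_space\<close>, so the domain of an outer
  measure is \<^term>\<open>UNIV :: 'a set set\<close>.\<close>

abbreviation measure_over :: "('a set \<Rightarrow> ennreal) \<Rightarrow> bool" where
  "measure_over \<phi> \<equiv> outer_measure_space UNIV \<phi>"

text \<open>\<^const>\<open>lambda_system\<close> is the library's formulation of Caratheodory measurability.\<close>

abbreviation carath_sets :: "('a set \<Rightarrow> ennreal) \<Rightarrow> 'a set set" where
  "carath_sets \<phi> \<equiv> lambda_system UNIV UNIV \<phi>"

text \<open>The restriction of an outer measure to its measurable sets, as a measure space. Since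
  \<^const>\<open>measure_of\<close> silently returns the zero measure on arguments that are not measures,
  the lemmas below confirm that this does not happen when \<open>\<phi>\<close> is an outer measure.\<close>

definition carath_measure :: "('a set \<Rightarrow> ennreal) \<Rightarrow> 'a measure" where
  "carath_measure \<phi> = measure_of UNIV (carath_sets \<phi>) \<phi>"

lemma measure_space_carath:
  assumes "measure_over \<phi>"
  shows "measure_space UNIV (carath_sets \<phi>) \<phi>"
  using sigma_algebra.caratheodory_lemma[of UNIV UNIV \<phi>] sigma_algebra_Pow[of "UNIV :: 'a set"] assms
  by simp

lemma sets_carath_measure:
  assumes "measure_over \<phi>"
  shows "sets (carath_measure \<phi>) = carath_sets \<phi>"
  using measure_space_carath[OF assms]
  by (simp add: carath_measure_def measure_space_def sigma_algebra.sets_measure_of_eq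
        sigma_algebra.sigma_sets_eq)

lemma emeasure_carath_measure:
  assumes "measure_over \<phi>" "B \<in> carath_sets \<phi>"
  shows "emeasure (carath_measure \<phi>) B = \<phi> B"
  using measure_space_carath[OF assms(1)] assms(2)
  by (auto simp: carath_measure_def measure_space_def intro: emeasure_measure_of_sigma)

definition borel_regular :: "('a::topological_space set \<Rightarrow> ennreal) \<Rightarrow> bool" where
  "borel_regular \<phi> \<longleftrightarrow>
     sets borel \<subseteq> carath_sets \<phi> \<and>
     (\<forall>E. \<exists>E'\<in>sets borel. E \<subseteq> E' \<and> \<phi> E' = \<phi> E)"

definition sigma_finite_set :: "('a set \<Rightarrow> ennreal) \<Rightarrow> 'a set \<Rightarrow> bool" where
  "sigma_finite_set \<phi> A \<longleftrightarrow>
     (\<exists>\<C>. countable \<C> \<and> A \<subseteq> \<Union>\<C> \<and> (\<forall>C\<in>\<C>. \<phi> C < \<infinity>))"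

definition abs_cont_on :: "('a set \<Rightarrow> ennreal) \<Rightarrow> ('a set \<Rightarrow> ennreal) \<Rightarrow> 'a set \<Rightarrow> bool" where
  "abs_cont_on \<mu> \<psi> A \<longleftrightarrow> (\<forall>N\<subseteq>A. \<psi> N = 0 \<longrightarrow> \<mu> N = 0)"


section \<open>Diameter and the Caratheodory construction\<close>

text \<open>The library's \<^const>\<open>diameter\<close> is real-valued, hence meaningless for unbounded sets.
  Here unbounded sets have diameter \<open>\<infinity>\<close>, and \<open>{}\<close> has diameter \<open>Sup {} = 0\<close>.\<close>

definition ediam :: "'a::metric_space set \<Rightarrow> ennreal" where
  "ediam S = (SUP x\<in>S. SUP y\<in>S. ennreal (dist x y))"

text \<open>A gauge on the class \<open>\<S>\<close> is a total function \<open>\<zeta>\<close> of which only the values on \<open>\<S>\<close> are ever used.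
  A countable, possibly finite or empty, family is indexed by an arbitrary set \<open>J\<close> of naturals.\<close>

definition carath_approx ::
  "'a::metric_space set set \<Rightarrow> ('a set \<Rightarrow> ennreal) \<Rightarrow> real \<Rightarrow> 'a set \<Rightarrow> ennreal" where
  "carath_approx \<S> \<zeta> \<delta> R =
     Inf {(\<Sum>\<^sub>\<infinity>j\<in>J. \<zeta> (E j)) | (J :: nat set) E.
            (\<forall>j\<in>J. E j \<in> \<S> \<and> ediam (E j) \<le> ennreal \<delta>) \<and> R \<subseteq> (\<Union>j\<in>J. E j)}"

definition carath_psi ::
  "'a::metric_space set set \<Rightarrow> ('a set \<Rightarrow> ennreal) \<Rightarrow> 'a set \<Rightarrow> ennreal" where
  "carath_psi \<S> \<zeta> R = (SUP \<delta>\<in>{0<..}. carath_approx \<S> \<zeta> \<delta> R)"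

definition covers_finely :: "'a::metric_space set set \<Rightarrow> 'a set \<Rightarrow> bool" where
  "covers_finely \<G> A \<longleftrightarrow>
     (\<forall>a\<in>A. \<forall>\<epsilon>::real. \<epsilon> > 0 \<longrightarrow> (\<exists>S\<in>\<G>. a \<in> S \<and> ediam S < ennreal \<epsilon>))"


section \<open>Federer density\<close>

definition admissible ::
  "'a set set \<Rightarrow> ('a set \<Rightarrow> ennreal) \<Rightarrow> ('a set \<Rightarrow> ennreal) \<Rightarrow> 'a set set" where
  "admissible \<S> \<mu> \<zeta> =
     \<S> - {S\<in>\<S>. (\<zeta> S = 0 \<and> \<mu> S = 0) \<or> (\<mu> S = \<infinity> \<and> \<zeta> S = \<infinity>)}"

definition quotient_fun ::
  "('a set \<Rightarrow> ennreal) \<Rightarrow> ('a set \<Rightarrow> ennreal) \<Rightarrow> 'a set \<Rightarrow> ennreal" where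
  "quotient_fun \<mu> \<zeta> S =
     (if \<zeta> S = 0 then \<infinity> else if \<zeta> S = \<infinity> then 0 else \<mu> S / \<zeta> S)"

text \<open>Only meaningful at points \<open>x\<close> that lie in admissible sets of arbitrarily small diameter
  (elsewhere the formula yields \<open>0\<close>).\<close>

definition federer_density ::
  "'a::metric_space set set \<Rightarrow> ('a set \<Rightarrow> ennreal) \<Rightarrow> ('a set \<Rightarrow> ennreal) \<Rightarrow> 'a \<Rightarrow> ennreal" where
  "federer_density \<S> \<zeta> \<mu> x =
     (INF \<epsilon>\<in>{0::real<..}. SUP S\<in>{S \<in> admissible \<S> \<mu> \<zeta>. x \<in> S \<and> ediam S < ennreal \<epsilon>}.
        quotient_fun \<mu> \<zeta> S)"

definition enlargement ::
  "'a::metric_space set set \<Rightarrow> ('a set \<Rightarrow> ennreal) \<Rightarrow> ('a set \<Rightarrow> ennreal) \<Rightarrow> real \<Rightarrow> 'a set \<Rightarrow> 'a set"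
  where
  "enlargement \<S> \<mu> \<zeta> \<tau> S =
     \<Union>{T \<in> admissible \<S> \<mu> \<zeta>. T \<inter> S \<noteq> {} \<and> ediam T \<le> ennreal \<tau> * ediam S}"

end

theory Submission
  imports Defs
begin

text \<open>On a set where the Federer density is below \<open>t\<close>, sufficiently fine covers satisfy
  \<open>\<mu> S \<le> t * \<zeta> S\<close> member by member, so \<open>\<mu> \<le> t * \<psi>\<close> there. Where the density exceeds \<open>t\<close>, the sets
  with \<open>\<mu> S > t * \<zeta> S\<close> lying in an open neighbourhood \<open>V\<close> form a fine cover, and a Vitali
  selection extracts a disjoint family of them; finitely many of its members together with the enlargements of the
  others still cover. As \<open>\<Sum> \<zeta> S \<le> \<mu> V / t\<close> converges, the enlarged tail is negligible, hence
  \<open>t * \<psi> \<le> \<mu> V\<close>, and outer regularity of \<open>\<mu>\<close> replaces \<open>V\<close> by the set itself. Slicing along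
  level sets of the density then gives the integral formula. Measurability with respect to \<open>\<mu>\<close>
  holds because a \<open>\<psi>\<close>-measurable subset of \<open>A\<close> is a Borel set up to a \<open>\<psi>\<close>-null subset of \<open>A\<close>, which is
  \<open>\<mu>\<close>-null by absolute continuity.\<close>


section \<open>Outer measures\<close>

text \<open>Two constants threaten the sharp bound \<open>t * \<psi> \<le> \<mu> V\<close>. The
  factor \<open>\<tau>\<close> pays for a selection by almost maximal diameter, since a supremum of
  diameters need not be attained; the enlargement absorbs it. The factor \<open>\<eta>\<close> would
  survive if every selected set were enlarged. Leaving the first \<open>N\<close> as they are
  confines it to a tail, and closedness permits this: a point outside their finite union lies in
  small sets that miss the union and so can only meet later members.

  The density values 0 and \<infinity> escape all slices and need finiteness. At density 0,
  \<open>\<mu> \<le> t * \<psi>\<close> for every \<open>t > 0\<close> forces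
  \<open>\<mu> = 0\<close> on pieces of finite \<open>\<psi>\<close>, which sigma-finiteness
  supplies. At density \<infinity>, \<open>t * \<psi> \<le> \<mu> V\<close> for every
  \<open>t\<close> forces \<open>\<psi> = 0\<close> inside open sets of finite \<open>\<mu>\<close>,
  and absolute continuity then gives \<open>\<mu> = 0\<close>.

  The points at which a bound on the quotients holds at a fixed scale need not form a measurable
  set. Hence the comparisons are proved for arbitrary sets, and limits along such sets rest on Borel
  regularity.\<close>

lemma outer_measure_zero: "measure_over \<phi> \<Longrightarrow> \<phi> {} = 0"
  by (simp add: outer_measure_space_def positive_def)

lemma outer_measure_mono: "measure_over \<phi> \<Longrightarrow> S \<subseteq> T \<Longrightarrow> \<phi> S \<le> \<phi> T"
  by (simp add: outer_measure_space_def increasing_def)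

text \<open>\<open>countably_subadditive\<close> speaks of disjoint sequences;
  \<open>disjointed E\<close> has the same union and smaller members, so monotonicity removes the
  restriction.\<close>

lemma outer_measure_UN:
  fixes E :: "nat \<Rightarrow> 'a set"
  assumes "measure_over \<phi>"
  shows "\<phi> (\<Union>n. E n) \<le> (\<Sum>n. \<phi> (E n))"
proof -
  have "\<phi> (\<Union>n. E n) = \<phi> (\<Union>n. disjointed E n)"
    by (simp add: UN_disjointed_eq)
  also have "\<dots> \<le> (\<Sum>n. \<phi> (disjointed E n))"
    using assms disjoint_family_disjointed[of E]
    unfolding outer_measure_space_def countably_subadditive_def by blast
  also have "\<dots> \<le> (\<Sum>n. \<phi> (E n))"
    by (intro suminf_le summableI allI outer_measure_mono[OF assms] disjointed_subset)
  finally show ?thesis .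
qed

lemma outer_measure_Un:
  assumes "measure_over \<phi>"
  shows "\<phi> (S \<union> T) \<le> \<phi> S + \<phi> T"
proof -
  have "\<phi> (S \<union> T) \<le> (\<Sum>n. \<phi> (binaryset S T n))"
    using outer_measure_UN[OF assms, of "binaryset S T"] by (simp add: UN_binaryset_eq)
  also have "\<dots> = \<phi> S + \<phi> T"
    using suminf_binaryset_eq[of \<phi> S T] outer_measure_zero[OF assms] by (simp add: o_def)
  finally show ?thesis .
qed

lemma outer_measure_UN_null:
  fixes E :: "nat \<Rightarrow> 'a set"
  assumes "measure_over \<phi>" "\<And>n. \<phi> (E n) = 0"
  shows "\<phi> (\<Union>n. E n) = 0"
  using outer_measure_UN[OF assms(1), of E] assms(2) by simp

lemma carath_sets_iff:
  "M \<in> carath_sets \<phi> \<longleftrightarrow> (\<forall>E. \<phi> (E \<inter> M) + \<phi> (E - M) = \<phi> E)"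
  by (auto simp: lambda_system_def Int_commute Diff_eq)

lemma carath_setsI:
  assumes "measure_over \<phi>" "\<And>E. \<phi> E < \<infinity> \<Longrightarrow> \<phi> (E \<inter> M) + \<phi> (E - M) \<le> \<phi> E"
  shows "M \<in> carath_sets \<phi>"
  unfolding carath_sets_iff
proof
  fix E
  have "\<phi> E \<le> \<phi> (E \<inter> M) + \<phi> (E - M)"
    using outer_measure_Un[OF assms(1), of "E \<inter> M" "E - M"] by (simp add: Int_Diff_Un)
  moreover have "\<phi> (E \<inter> M) + \<phi> (E - M) \<le> \<phi> E"
    using assms(2)[of E] by (cases "\<phi> E = \<infinity>") (auto simp: less_top)
  ultimately show "\<phi> (E \<inter> M) + \<phi> (E - M) = \<phi> E" by simp
qed

lemma null_carath_sets:
  assumes "measure_over \<phi>" "\<phi> N = 0"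
  shows "N \<in> carath_sets \<phi>"
proof (rule carath_setsI[OF assms(1)])
  fix E
  have "\<phi> (E \<inter> N) = 0"
    using outer_measure_mono[OF assms(1), of "E \<inter> N" N] assms(2) by simp
  thus "\<phi> (E \<inter> N) + \<phi> (E - N) \<le> \<phi> E"
    using outer_measure_mono[OF assms(1), of "E - N" E] by simp
qed

lemma sigma_algebra_carath_sets:
  "measure_over \<phi> \<Longrightarrow> sigma_algebra UNIV (carath_sets \<phi>)"
  using measure_space_carath by (auto simp: measure_space_def)

lemma space_carath_measure [simp]: "space (carath_measure \<phi>) = UNIV"
  by (auto simp: carath_measure_def space_measure_of_conv)

section \<open>The Caratheodory construction\<close>

text \<open>Padding with zeros outside \<open>J\<close> turns the sum over an arbitrary index set
  into an ordinary series, the form in which all later estimates on covers are carried out.\<close>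

lemma infsum_eq_suminf_if:
  fixes \<zeta> :: "'a set \<Rightarrow> ennreal" and J :: "nat set"
  shows "(\<Sum>\<^sub>\<infinity>j\<in>J. \<zeta> (E j)) = (\<Sum>j. if j \<in> J then \<zeta> (E j) else 0)"
proof -
  have "(\<Sum>\<^sub>\<infinity>j\<in>J. \<zeta> (E j)) = (\<Sum>\<^sub>\<infinity>j. if j \<in> J then \<zeta> (E j) else 0)"
    by (rule infsum_cong_neutral) auto
  also have "\<dots> = (\<Sum>j. if j \<in> J then \<zeta> (E j) else 0)"
    by (intro sums_unique has_sum_imp_sums has_sum_infsum nonneg_summable_on_complete) simp
  finally show ?thesis .
qed

lemma carath_approx_le:
  assumes "\<And>j. j \<in> J \<Longrightarrow> E j \<in> \<S>" "\<And>j. j \<in> J \<Longrightarrow> ediam (E j) \<le> ennreal \<delta>"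
    and "R \<subseteq> (\<Union>j\<in>J. E j)"
  shows "carath_approx \<S> \<zeta> \<delta> R \<le> (\<Sum>j. if j \<in> J then \<zeta> (E j) else 0)"
  unfolding carath_approx_def infsum_eq_suminf_if
  by (rule Inf_lower) (use assms in blast)

lemma carath_approx_less:
  assumes "carath_approx \<S> \<zeta> \<delta> R < r"
  obtains J E where "\<And>j. j \<in> J \<Longrightarrow> E j \<in> \<S>" "\<And>j. j \<in> J \<Longrightarrow> ediam (E j) \<le> ennreal \<delta>"
    "R \<subseteq> (\<Union>j\<in>J. E j)" "(\<Sum>j. if j \<in> J then \<zeta> (E j) else 0) < r"
  using assms unfolding carath_approx_def infsum_eq_suminf_if Inf_less_iff
  by blast

lemma le_carath_approx:
  assumes "\<And>J E. (\<And>j. j \<in> J \<Longrightarrow> E j \<in> \<S>) \<Longrightarrow> (\<And>j. j \<in> J \<Longrightarrow> ediam (E j) \<le> ennreal \<delta>) \<Longrightarrow>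
    R \<subseteq> (\<Union>j\<in>J. E j) \<Longrightarrow> x \<le> (\<Sum>j. if j \<in> J then \<zeta> (E j) else 0)"
  shows "x \<le> carath_approx \<S> \<zeta> \<delta> R"
  unfolding carath_approx_def infsum_eq_suminf_if
  by (rule Inf_greatest) (use assms in blast)

lemma carath_approx_mono:
  assumes "R \<subseteq> R'" "\<delta>' \<le> \<delta>"
  shows "carath_approx \<S> \<zeta> \<delta> R \<le> carath_approx \<S> \<zeta> \<delta>' R'"
proof (rule le_carath_approx, rule carath_approx_le)
  fix J :: "nat set" and E j
  assume "\<And>j. j \<in> J \<Longrightarrow> ediam (E j) \<le> ennreal \<delta>'" "j \<in> J"
  thus "ediam (E j) \<le> ennreal \<delta>"
    using ennreal_leI[OF assms(2)] order_trans by blast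
qed (use assms(1) in blast)+

text \<open>Covers of the \<open>R n\<close> that are optimal up to \<open>e / 2 ^ (n + 1)\<close>
  merge into one cover of the union, with total excess \<open>e\<close>.\<close>

lemma carath_approx_UN:
  fixes R :: "nat \<Rightarrow> 'a::metric_space set"
  shows "carath_approx \<S> \<zeta> \<delta> (\<Union>n. R n) \<le> (\<Sum>n. carath_approx \<S> \<zeta> \<delta> (R n))"
proof (rule ennreal_le_epsilon)
  fix e :: real
  assume "0 < e" and fin: "(\<Sum>n. carath_approx \<S> \<zeta> \<delta> (R n)) < top"
  have "\<exists>J E. (\<forall>j\<in>J. E j \<in> \<S> \<and> ediam (E j) \<le> ennreal \<delta>) \<and> R n \<subseteq> (\<Union>j\<in>J. E j) \<and>
      (\<Sum>j. if j \<in> J then \<zeta> (E j) else 0) < carath_approx \<S> \<zeta> \<delta> (R n) + ennreal (e * (1/2)^Suc n)"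
    (is "\<exists>J E. ?P n J E") for n
  proof -
    have "carath_approx \<S> \<zeta> \<delta> (R n) < top"
      using ennreal_suminf_lessD[OF fin] by blast
    hence "carath_approx \<S> \<zeta> \<delta> (R n) < carath_approx \<S> \<zeta> \<delta> (R n) + ennreal (e * (1/2)^Suc n)"
      using \<open>0 < e\<close> by (cases "carath_approx \<S> \<zeta> \<delta> (R n)") (auto simp: ennreal_less_iff simp flip: ennreal_plus)
    then show ?thesis
    proof (rule carath_approx_less)
      fix J E
      assume "\<And>j::nat. j \<in> J \<Longrightarrow> E j \<in> \<S>" "\<And>j. j \<in> J \<Longrightarrow> ediam (E j) \<le> ennreal \<delta>"
        "R n \<subseteq> (\<Union>j\<in>J. E j)"
        "(\<Sum>j. if j \<in> J then \<zeta> (E j) else 0) < carath_approx \<S> \<zeta> \<delta> (R n) + ennreal (e * (1/2)^Suc n)"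
      thus ?thesis by (intro exI[of _ J] exI[of _ E]) simp
    qed
  qed
  hence "\<forall>n. \<exists>J E. ?P n J E" ..
  from choice[OF this] obtain J where "\<forall>n. \<exists>E. ?P n (J n) E" ..
  from choice[OF this] obtain E where JE: "\<forall>n. ?P n (J n) (E n)" ..
  \<comment> \<open>The double family is enumerated by the pairing of naturals; \<open>K\<close>
    keeps those codes \<open>(n, j)\<close> for which \<open>j\<close> really indexes a member of
    the \<open>n\<close>-th cover.\<close>
  define K where "K = {m. snd (prod_decode m) \<in> J (fst (prod_decode m))}"
  define D where "D m = E (fst (prod_decode m)) (snd (prod_decode m))" for m
  have "(\<Union>n. R n) \<subseteq> (\<Union>m\<in>K. D m)"
  proof
    fix x assume "x \<in> (\<Union>n. R n)"
    then obtain n j where "j \<in> J n" "x \<in> E n j" using JE by blast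
    hence "prod_encode (n, j) \<in> K" "x \<in> D (prod_encode (n, j))"
      by (auto simp: K_def D_def)
    thus "x \<in> (\<Union>m\<in>K. D m)" by blast
  qed
  hence "carath_approx \<S> \<zeta> \<delta> (\<Union>n. R n) \<le> (\<Sum>m. if m \<in> K then \<zeta> (D m) else 0)"
    by (intro carath_approx_le) (use JE in \<open>auto simp: K_def D_def\<close>)
  also have "\<dots> = (\<Sum>m. (\<lambda>(n, j). if j \<in> J n then \<zeta> (E n j) else 0) (prod_decode m))"
    by (auto simp: K_def D_def case_prod_beta intro!: suminf_cong)
  also have "\<dots> = (\<Sum>n. \<Sum>j. if j \<in> J n then \<zeta> (E n j) else 0)"
    by (rule suminf_ennreal_2dimen) simp
  also have "\<dots> \<le> (\<Sum>n. carath_approx \<S> \<zeta> \<delta> (R n) + ennreal (e * (1/2)^Suc n))"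
    using JE by (intro suminf_le summableI allI) (auto intro: less_imp_le)
  also have "\<dots> = (\<Sum>n. carath_approx \<S> \<zeta> \<delta> (R n)) + (\<Sum>n. ennreal (e * (1/2)^Suc n))"
    by (intro suminf_add[symmetric] summableI)
  also have "(\<Sum>n. ennreal (e * (1/2)^Suc n)) = ennreal e"
    using \<open>0 < e\<close> sums_mult[OF power_half_series, of e] by (intro suminf_ennreal_eq) auto
  finally show "carath_approx \<S> \<zeta> \<delta> (\<Union>n. R n) \<le> (\<Sum>n. carath_approx \<S> \<zeta> \<delta> (R n)) + ennreal e" .
qed

lemma carath_approx_le_psi: "0 < \<delta> \<Longrightarrow> carath_approx \<S> \<zeta> \<delta> R \<le> carath_psi \<S> \<zeta> R"
  unfolding carath_psi_def by (intro SUP_upper) simp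

lemma carath_psi_leI: "(\<And>\<delta>. 0 < \<delta> \<Longrightarrow> carath_approx \<S> \<zeta> \<delta> R \<le> x) \<Longrightarrow> carath_psi \<S> \<zeta> R \<le> x"
  unfolding carath_psi_def by (intro SUP_least) simp

lemma measure_over_carath_psi: "measure_over (carath_psi \<S> \<zeta>)"
  unfolding outer_measure_space_def
proof (intro conjI)
  \<comment> \<open>The empty family, with \<open>J = {}\<close>, covers the empty set, so no member
    of \<open>\<S>\<close> of small gauge is required.\<close>
  have "carath_approx \<S> \<zeta> \<delta> {} = 0" for \<delta>
    using carath_approx_le[of "{}" _ \<S> \<delta> "{}" \<zeta>] by simp
  thus "positive UNIV (carath_psi \<S> \<zeta>)"
    by (simp add: positive_def carath_psi_def)
  show "increasing UNIV (carath_psi \<S> \<zeta>)"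
    by (auto simp: increasing_def
        intro!: carath_psi_leI order_trans[OF carath_approx_mono carath_approx_le_psi])
  show "countably_subadditive UNIV (carath_psi \<S> \<zeta>)"
    by (auto simp: countably_subadditive_def intro!: carath_psi_leI order_trans[OF carath_approx_UN]
        suminf_le summableI carath_approx_le_psi)
qed

section \<open>Additivity over separated sets and measurability of Borel sets\<close>

lemma dist_le_ediam: "x \<in> S \<Longrightarrow> y \<in> S \<Longrightarrow> ennreal (dist x y) \<le> ediam S"
  unfolding ediam_def by (intro SUP_upper2[of x] SUP_upper2[of y]) auto

lemma dist_le_of_ediam_le: "x \<in> S \<Longrightarrow> y \<in> S \<Longrightarrow> ediam S \<le> ennreal \<delta> \<Longrightarrow> 0 \<le> \<delta> \<Longrightarrow> dist x y \<le> \<delta>"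
  using order_trans[OF dist_le_ediam, of x S y "ennreal \<delta>"] by simp

lemma dist_less_of_ediam_less: "x \<in> S \<Longrightarrow> y \<in> S \<Longrightarrow> ediam S < ennreal \<delta> \<Longrightarrow> dist x y < \<delta>"
  using le_less_trans[OF dist_le_ediam, of x S y "ennreal \<delta>"] by (simp add: ennreal_less_iff)

text \<open>A set of diameter at most \<open>\<delta> < d\<close> cannot meet both \<open>P\<close>
  and \<open>Q\<close>, so every sufficiently fine cover of the union splits into two subfamilies
  without common index, one covering each part.\<close>

lemma carath_psi_add_separated:
  assumes "0 < d" and sep: "\<And>p q. p \<in> P \<Longrightarrow> q \<in> Q \<Longrightarrow> d \<le> dist p q"
  shows "carath_psi \<S> \<zeta> P + carath_psi \<S> \<zeta> Q \<le> carath_psi \<S> \<zeta> (P \<union> Q)"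
proof -
  have small: "carath_approx \<S> \<zeta> \<delta> P + carath_approx \<S> \<zeta> \<delta> Q \<le> carath_approx \<S> \<zeta> \<delta> (P \<union> Q)"
    if "0 < \<delta>" "\<delta> < d" for \<delta>
  proof (rule le_carath_approx)
    fix J E
    assume JE: "\<And>j::nat. j \<in> J \<Longrightarrow> E j \<in> \<S>" "\<And>j. j \<in> J \<Longrightarrow> ediam (E j) \<le> ennreal \<delta>"
      "P \<union> Q \<subseteq> (\<Union>j\<in>J. E j)"
    let ?J = "\<lambda>R. {j\<in>J. E j \<inter> R \<noteq> {}}"
    have disj: False if "j \<in> ?J P" "j \<in> ?J Q" for j
    proof -
      from that obtain p q where "j \<in> J" "p \<in> E j" "q \<in> E j" "p \<in> P" "q \<in> Q" by auto
      thus False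
        using sep[of p q] dist_le_of_ediam_le[of p "E j" q \<delta>] JE(2) \<open>0 < \<delta>\<close> \<open>\<delta> < d\<close> by fastforce
    qed
    have "carath_approx \<S> \<zeta> \<delta> P + carath_approx \<S> \<zeta> \<delta> Q \<le>
        (\<Sum>j. if j \<in> ?J P then \<zeta> (E j) else 0) + (\<Sum>j. if j \<in> ?J Q then \<zeta> (E j) else 0)"
      by (intro add_mono carath_approx_le) (use JE in blast)+
    also have "\<dots> = (\<Sum>j. (if j \<in> ?J P then \<zeta> (E j) else 0) + (if j \<in> ?J Q then \<zeta> (E j) else 0))"
      by (intro suminf_add summableI)
    also have "\<dots> \<le> (\<Sum>j. if j \<in> J then \<zeta> (E j) else 0)"
      using disj by (intro suminf_le summableI allI) auto
    finally show "carath_approx \<S> \<zeta> \<delta> P + carath_approx \<S> \<zeta> \<delta> Q \<le>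
      (\<Sum>j. if j \<in> J then \<zeta> (E j) else 0)" .
  qed
  \<comment> \<open>The two suprema combine into one because the approximations grow as
    \<open>\<delta>\<close> shrinks, so \<open>min i j\<close> dominates both indices.\<close>
  have "carath_psi \<S> \<zeta> P + carath_psi \<S> \<zeta> Q =
      (SUP \<delta>\<in>{0<..}. carath_approx \<S> \<zeta> \<delta> P + carath_approx \<S> \<zeta> \<delta> Q)"
    unfolding carath_psi_def
  proof (rule SUP_add_directed_ennreal[symmetric])
    fix i j :: real assume "i \<in> {0<..}" "j \<in> {0<..}"
    thus "\<exists>k\<in>{0<..}. carath_approx \<S> \<zeta> i P + carath_approx \<S> \<zeta> j Q
        \<le> carath_approx \<S> \<zeta> k P + carath_approx \<S> \<zeta> k Q"
      by (intro bexI[of _ "min i j"] add_mono carath_approx_mono) auto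
  qed
  also have "\<dots> \<le> carath_psi \<S> \<zeta> (P \<union> Q)"
  proof (rule SUP_least)
    fix \<delta> :: real assume "\<delta> \<in> {0<..}"
    let ?\<delta> = "min \<delta> (d/2)"
    have "carath_approx \<S> \<zeta> \<delta> P + carath_approx \<S> \<zeta> \<delta> Q
        \<le> carath_approx \<S> \<zeta> ?\<delta> P + carath_approx \<S> \<zeta> ?\<delta> Q"
      by (intro add_mono carath_approx_mono) auto
    also have "\<dots> \<le> carath_approx \<S> \<zeta> ?\<delta> (P \<union> Q)"
      using \<open>\<delta> \<in> {0<..}\<close> \<open>0 < d\<close> by (intro small) auto
    also have "\<dots> \<le> carath_psi \<S> \<zeta> (P \<union> Q)"
      using \<open>\<delta> \<in> {0<..}\<close> \<open>0 < d\<close> by (intro carath_approx_le_psi) auto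
    finally show "carath_approx \<S> \<zeta> \<delta> P + carath_approx \<S> \<zeta> \<delta> Q \<le> carath_psi \<S> \<zeta> (P \<union> Q)" .
  qed
  finally show ?thesis .
qed


text \<open>The tails of a convergent series tend to 0. Subtraction is avoided: partial sums are
  added to both sides, which completes the tail to the whole series, and the finite total is
  cancelled at the end. It serves both the layers around a closed set and the enlarged tail of a
  disjoint selection.\<close>

lemma le_of_le_add_tails:
  fixes f :: "nat \<Rightarrow> ennreal"
  assumes fin: "(\<Sum>i. f i) < \<infinity>" and le: "\<And>n. x \<le> y + (\<Sum>i. f (i + n))"
  shows "x \<le> y"
proof -
  have "(\<Sum>n<N. f n) + x \<le> (\<Sum>n. f n) + y" for N
  proof -
    have "(\<Sum>n<N. f n) + x \<le> (\<Sum>n<N. f n) + (y + (\<Sum>i. f (i + N)))"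
      by (intro add_left_mono le)
    also have "\<dots> = (\<Sum>n. f n) + y"
      using suminf_offset[of f N] by (simp add: summableI ac_simps)
    finally show ?thesis .
  qed
  hence "(\<Sum>n. f n) + x \<le> (\<Sum>n. f n) + y"
    using ennreal_suminf_bound_add[of f x] by simp
  thus ?thesis
    using fin by (auto simp: ennreal_add_left_cancel_le)
qed

lemma suminf_double_le:
  fixes f :: "nat \<Rightarrow> ennreal"
  assumes "\<And>N. (\<Sum>n<N. f (2 * n)) \<le> x" "\<And>N. (\<Sum>n<N. f (2 * n + 1)) \<le> y"
  shows "(\<Sum>n. f n) \<le> x + y"
proof (rule suminf_le_const[OF summableI])
  fix N
  have split: "(\<Sum>n<2 * N. f n) = (\<Sum>n<N. f (2 * n)) + (\<Sum>n<N. f (2 * n + 1))"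
    by (induction N) (auto simp: ac_simps)
  have "(\<Sum>n<N. f n) \<le> (\<Sum>n<2 * N. f n)"
    by (rule sum_mono2) auto
  also have "\<dots> \<le> x + y"
    unfolding split by (intro add_mono assms)
  finally show "(\<Sum>n<N. f n) \<le> x + y" .
qed

text \<open>Caratheodory's criterion: the layers \<open>R n\<close> of points at distance between \<open>1 / (n + 2)\<close> and
  \<open>1 / (n + 1)\<close> from \<open>C\<close> are pairwise separated within each parity class, so \<open>\<Sum> \<phi> (R n)\<close> converges.\<close>

lemma closed_carath_sets:
  fixes \<phi> :: "'a::metric_space set \<Rightarrow> ennreal"
  assumes \<phi>: "measure_over \<phi>"
    and add: "\<And>d P Q. 0 < d \<Longrightarrow> (\<And>p q. p \<in> P \<Longrightarrow> q \<in> Q \<Longrightarrow> d \<le> dist p q) \<Longrightarrow>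
      \<phi> P + \<phi> Q \<le> \<phi> (P \<union> Q)"
    and "closed C"
  shows "C \<in> carath_sets \<phi>"
proof (cases "C = {}")
  case True
  thus ?thesis by (simp add: null_carath_sets[OF \<phi>] outer_measure_zero[OF \<phi>])
next
  case False
  show ?thesis
  proof (rule carath_setsI[OF \<phi>])
    fix E assume fin: "\<phi> E < \<infinity>"
    define D where "D n = {x\<in>E. inverse (real (Suc n)) \<le> infdist x C}" for n
    define R where "R n = D (Suc n) - D n" for n
    have D_mono: "D m \<subseteq> D n" if "m \<le> n" for m n
    proof
      fix x assume "x \<in> D m"
      moreover have "inverse (real (Suc n)) \<le> inverse (real (Suc m))"
        using that by (intro le_imp_inverse_le) auto
      ultimately show "x \<in> D n" unfolding D_def by (blast intro: order_trans)
    qed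
    have RE: "R n \<subseteq> E" for n by (auto simp: R_def D_def)
    have far: "inverse (real m) - inverse (real n) \<le> dist p q"
      if "inverse (real m) \<le> infdist p C" "infdist q C < inverse (real n)" for m n p q
      using infdist_triangle[of p C q] that by (simp add: dist_commute)
    \<comment> \<open>The offset \<open>a\<close> selects the parity class: 0 for the even layers, 1
      for the odd ones.\<close>
    have sum_R: "(\<Sum>n<N. \<phi> (R (2 * n + a))) \<le> \<phi> (\<Union>n<N. R (2 * n + a))" for N a
    proof (induction N)
      case 0
      show ?case by simp
    next
      case (Suc N)
      let ?P = "\<Union>n<N. R (2 * n + a)"
      have "\<phi> ?P + \<phi> (R (2 * N + a)) \<le> \<phi> (?P \<union> R (2 * N + a))"
      \<comment> \<open>With \<open>N = 0\<close> there is no earlier layer to separate from; for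
        \<open>a = 0\<close> the gap \<open>?d\<close> below would even be negative, since
        \<open>inverse 0 = 0\<close>.\<close>
      proof (cases "N = 0")
        case True
        thus ?thesis by (simp add: outer_measure_zero[OF \<phi>])
      next
        case False
        let ?d = "inverse (real (2 * N + a)) - inverse (real (Suc (2 * N + a)))"
        show ?thesis
        proof (rule add[of ?d])
          show "0 < ?d" using False by (simp add: less_imp_inverse_less)
          fix p q assume "p \<in> ?P" "q \<in> R (2 * N + a)"
          then obtain n where "n < N" "p \<in> D (Suc (2 * n + a))" by (auto simp: R_def)
          \<comment> \<open>The omitted layer of the other parity creates the gap: earlier points
            lie in \<open>D (2 * N + a - 1)\<close>, at distance at least
            \<open>inverse (2 * N + a)\<close> from \<open>C\<close>, whereas points of the new
            layer lie outside \<open>D (2 * N + a)\<close>.\<close>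
          hence "p \<in> D (2 * N + a - 1)"
            using D_mono[of "Suc (2 * n + a)" "2 * N + a - 1"] by fastforce
          moreover have "Suc (2 * N + a - 1) = 2 * N + a" using False by simp
          ultimately have "inverse (real (2 * N + a)) \<le> infdist p C"
            by (simp add: D_def)
          moreover have "infdist q C < inverse (real (Suc (2 * N + a)))"
            using \<open>q \<in> R (2 * N + a)\<close> by (auto simp: R_def D_def)
          ultimately show "?d \<le> dist p q" by (rule far)
        qed
      qed
      moreover have "(\<Union>n<Suc N. R (2 * n + a)) = ?P \<union> R (2 * N + a)"
        by (auto simp: less_Suc_eq)
      ultimately show ?case
        using Suc.IH by (auto intro: order_trans add_right_mono)
    qed
    have sum_RE: "(\<Sum>n<N. \<phi> (R (2 * n + a))) \<le> \<phi> E" for N a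
      using RE by (intro order_trans[OF sum_R] outer_measure_mono[OF \<phi>]) auto
    have "(\<Sum>n. \<phi> (R n)) \<le> \<phi> E + \<phi> E"
      using sum_RE[where a=0] sum_RE[where a=1] by (intro suminf_double_le) auto
    hence sum_fin: "(\<Sum>n. \<phi> (R n)) < \<infinity>"
      using fin by (auto simp: le_less_trans)
    show "\<phi> (E \<inter> C) + \<phi> (E - C) \<le> \<phi> E"
    proof (rule le_of_le_add_tails[OF sum_fin])
      fix n
      \<comment> \<open>As \<open>C\<close> is closed, a point off \<open>C\<close> has positive
        distance to it and lies in some \<open>D k\<close>; if it is not yet in \<open>D n\<close>,
        it entered at a layer with index at least \<open>n\<close>.\<close>
      have "E - C \<subseteq> D n \<union> (\<Union>i. R (i + n))"
      proof
        fix x assume x: "x \<in> E - C"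
        hence "0 < infdist x C"
          using \<open>closed C\<close> False by (simp add: in_closed_iff_infdist_zero less_le infdist_nonneg)
        then obtain m where "inverse (real (Suc m)) < infdist x C"
          using reals_Archimedean by blast
        hence "x \<in> D (max m n)" using x D_mono[of m "max m n"] by (auto simp: D_def)
        have "x \<in> D (k + n) \<Longrightarrow> x \<in> D n \<union> (\<Union>i. R (i + n))" for k
          by (induction k) (auto simp: R_def)
        from this[of "max m n - n"] show "x \<in> D n \<union> (\<Union>i. R (i + n))"
          using \<open>x \<in> D (max m n)\<close> by simp
      qed
      hence "\<phi> (E - C) \<le> \<phi> (D n \<union> (\<Union>i. R (i + n)))"
        by (rule outer_measure_mono[OF \<phi>])
      also have "\<dots> \<le> \<phi> (D n) + \<phi> (\<Union>i. R (i + n))"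
        by (rule outer_measure_Un[OF \<phi>])
      also have "\<dots> \<le> \<phi> (D n) + (\<Sum>i. \<phi> (R (i + n)))"
        by (intro add_left_mono outer_measure_UN[OF \<phi>])
      finally have "\<phi> (E \<inter> C) + \<phi> (E - C) \<le> (\<phi> (E \<inter> C) + \<phi> (D n)) + (\<Sum>i. \<phi> (R (i + n)))"
        by (simp add: add.assoc add_left_mono)
      also have "\<phi> (E \<inter> C) + \<phi> (D n) \<le> \<phi> (E \<inter> C \<union> D n)"
      proof (rule add)
        show "0 < inverse (real (Suc n))" by simp
        fix p q assume "p \<in> E \<inter> C" "q \<in> D n"
        thus "inverse (real (Suc n)) \<le> dist p q"
          using infdist_le[of p C q] by (simp add: D_def dist_commute)
      qed
      also have "\<phi> (E \<inter> C \<union> D n) \<le> \<phi> E"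
        by (intro outer_measure_mono[OF \<phi>]) (auto simp: D_def)
      finally show "\<phi> (E \<inter> C) + \<phi> (E - C) \<le> \<phi> E + (\<Sum>i. \<phi> (R (i + n)))"
        by (simp add: add_right_mono)
    qed
  qed
qed

lemma borel_subset_carath_sets:
  fixes \<phi> :: "'a::metric_space set \<Rightarrow> ennreal"
  assumes \<phi>: "measure_over \<phi>" and closed: "\<And>C. closed C \<Longrightarrow> C \<in> carath_sets \<phi>"
  shows "sets borel \<subseteq> carath_sets \<phi>"
proof -
  interpret sigma_algebra UNIV "carath_sets \<phi>"
    by (rule sigma_algebra_carath_sets[OF \<phi>])
  have "S \<in> carath_sets \<phi>" if "open S" for S
    using compl_sets[OF closed[of "- S"]] that by (simp add: closed_Compl flip: Compl_eq_Diff_UNIV)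
  thus ?thesis
    unfolding sets_borel by (intro sigma_sets_subset) auto
qed

text \<open>Since the members of \<open>\<S>\<close> are Borel, the union of a near-optimal cover is
  a Borel superset whose approximate value is under control. Intersecting over \<open>n\<close>,
  with \<open>1 / (n + 1)\<close> serving both as mesh and as allowed excess, gives a hull of the
  same \<open>\<psi>\<close>-value.\<close>

lemma borel_regular_carath_psi:
  assumes "\<forall>S\<in>\<S>. S \<in> sets borel"
  shows "borel_regular (carath_psi \<S> \<zeta>)"
  unfolding borel_regular_def
proof (intro conjI allI)
  show "sets borel \<subseteq> carath_sets (carath_psi \<S> \<zeta>)"
    by (intro borel_subset_carath_sets closed_carath_sets measure_over_carath_psi
        carath_psi_add_separated)
next
  fix E
  let ?\<psi> = "carath_psi \<S> \<zeta>"
  have mono: "?\<psi> P \<le> ?\<psi> Q" if "P \<subseteq> Q" for P Q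
    using outer_measure_mono[OF measure_over_carath_psi that] .
  show "\<exists>E'\<in>sets borel. E \<subseteq> E' \<and> ?\<psi> E' = ?\<psi> E"
  proof (cases "?\<psi> E = \<infinity>")
    case True
    thus ?thesis using mono[of E UNIV] by (intro bexI[of _ UNIV]) (auto simp: top_unique)
  next
    case False
    have "\<exists>H\<in>sets borel. E \<subseteq> H \<and>
        carath_approx \<S> \<zeta> (inverse (Suc n)) H \<le> ?\<psi> E + ennreal (inverse (Suc n))" for n
    proof -
      have "carath_approx \<S> \<zeta> (inverse (Suc n)) E \<le> ?\<psi> E"
        by (intro carath_approx_le_psi) simp
      also have "\<dots> < ?\<psi> E + ennreal (inverse (Suc n))"
        using False by (cases "?\<psi> E") (auto simp: ennreal_less_iff simp flip: ennreal_plus)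
      finally show ?thesis
      proof (rule carath_approx_less)
        fix J D
        assume JD: "\<And>j::nat. j \<in> J \<Longrightarrow> D j \<in> \<S>" "\<And>j. j \<in> J \<Longrightarrow> ediam (D j) \<le> ennreal (inverse (Suc n))"
          "E \<subseteq> (\<Union>j\<in>J. D j)"
          "(\<Sum>j. if j \<in> J then \<zeta> (D j) else 0) < ?\<psi> E + ennreal (inverse (Suc n))"
        have "carath_approx \<S> \<zeta> (inverse (Suc n)) (\<Union>j\<in>J. D j) \<le> (\<Sum>j. if j \<in> J then \<zeta> (D j) else 0)"
          by (rule carath_approx_le) (use JD in auto)
        moreover have "(\<Union>j\<in>J. D j) \<in> sets borel"
          using assms JD(1) by (intro sets.countable_UN') auto
        ultimately show ?thesis
          using JD(3,4) by (intro bexI[of _ "\<Union>j\<in>J. D j"]) auto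
      qed
    qed
    hence "\<forall>n. \<exists>H. H \<in> sets borel \<and> E \<subseteq> H \<and>
        carath_approx \<S> \<zeta> (inverse (Suc n)) H \<le> ?\<psi> E + ennreal (inverse (Suc n))" by blast
    from choice[OF this] obtain H where H: "\<And>n. H n \<in> sets borel" "\<And>n. E \<subseteq> H n"
      "\<And>n. carath_approx \<S> \<zeta> (inverse (Suc n)) (H n) \<le> ?\<psi> E + ennreal (inverse (Suc n))"
      by blast
    have "?\<psi> (\<Inter>n. H n) \<le> ?\<psi> E"
    proof (rule carath_psi_leI, rule ennreal_le_epsilon)
      fix \<delta> e :: real assume "0 < \<delta>" "0 < e"
      then obtain n where n: "inverse (real (Suc n)) < min \<delta> e"
        using reals_Archimedean[of "min \<delta> e"] by auto
      have "carath_approx \<S> \<zeta> \<delta> (\<Inter>n. H n) \<le> carath_approx \<S> \<zeta> (inverse (Suc n)) (H n)"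
        using n by (intro carath_approx_mono) auto
      also have "\<dots> \<le> ?\<psi> E + ennreal e"
        using n by (intro order_trans[OF H(3)] add_left_mono ennreal_leI) auto
      finally show "carath_approx \<S> \<zeta> \<delta> (\<Inter>n. H n) \<le> ?\<psi> E + ennreal e" .
    qed
    moreover have "E \<subseteq> (\<Inter>n. H n)" using H(2) by blast
    ultimately show ?thesis
      using H(1) mono[of E "\<Inter>n. H n"] by (intro bexI[of _ "\<Inter>n. H n"]) auto
  qed
qed

section \<open>Approximation by Borel and open sets\<close>

lemma countable_cover_sequence:
  assumes "countable \<C>" "A \<subseteq> \<Union>\<C>" "\<forall>C\<in>\<C>. P C" "P {}"
  shows "\<exists>C :: nat \<Rightarrow> 'a set. A \<subseteq> (\<Union>n. C n) \<and> (\<forall>n. P (C n))"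
proof (intro exI conjI allI)
  show "A \<subseteq> (\<Union>n. from_nat_into (insert {} \<C>) n)"
    using assms(1,2) by (subst range_from_nat_into) auto
  show "P (from_nat_into (insert {} \<C>) n)" for n
    using from_nat_into[of "insert {} \<C>" n] assms(3,4) by auto
qed

text \<open>A Borel hull \<open>H\<close> of \<open>B\<close> exceeds it by a null set, because a
  finite value can be cancelled. That null set lies in a Borel null set \<open>Z\<close>, and
  \<open>H - Z\<close> is the required inner set.\<close>

lemma borel_inner_approx_finite:
  assumes \<phi>: "measure_over \<phi>" "borel_regular \<phi>" and B: "B \<in> carath_sets \<phi>" "\<phi> B < \<infinity>"
  shows "\<exists>K\<in>sets borel. K \<subseteq> B \<and> \<phi> (B - K) = 0"
proof -
  obtain H where H: "H \<in> sets borel" "B \<subseteq> H" "\<phi> H = \<phi> B"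
    using \<phi>(2) unfolding borel_regular_def by blast
  have "\<phi> (H \<inter> B) + \<phi> (H - B) = \<phi> H"
    using B(1) by (simp add: carath_sets_iff)
  moreover have "H \<inter> B = B" using H(2) by blast
  ultimately have "\<phi> B + \<phi> (H - B) = \<phi> B + 0" by (simp add: H(3))
  hence "\<phi> (H - B) = 0"
    using B(2) by (subst (asm) ennreal_add_left_cancel) auto
  moreover obtain Z where Z: "Z \<in> sets borel" "H - B \<subseteq> Z" "\<phi> Z = \<phi> (H - B)"
    using \<phi>(2) unfolding borel_regular_def by blast
  ultimately have "\<phi> (B - (H - Z)) = 0"
    using outer_measure_mono[OF \<phi>(1), of "B - (H - Z)" Z] H(2) by auto
  thus ?thesis
    using H Z by (intro bexI[of _ "H - Z"]) auto
qed

text \<open>The sets \<open>C n\<close> of a sigma-finite cover may fail to be measurable; cutting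
  \<open>B\<close> by their Borel hulls instead keeps the pieces measurable and of finite
  measure.\<close>

lemma borel_inner_approx:
  assumes \<phi>: "measure_over \<phi>" "borel_regular \<phi>" and B: "B \<in> carath_sets \<phi>" "sigma_finite_set \<phi> B"
  shows "\<exists>K\<in>sets borel. K \<subseteq> B \<and> \<phi> (B - K) = 0"
proof -
  obtain \<C> where "countable \<C>" "B \<subseteq> \<Union>\<C>" "\<forall>C\<in>\<C>. \<phi> C < \<infinity>"
    using B(2) unfolding sigma_finite_set_def by blast
  from countable_cover_sequence[OF this] obtain C where C: "B \<subseteq> (\<Union>n. C n)" "\<And>n::nat. \<phi> (C n) < \<infinity>"
    using outer_measure_zero[OF \<phi>(1)] by auto
  have "\<exists>K\<in>sets borel. K \<subseteq> B \<and> \<phi> (B \<inter> C n - K) = 0" for n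
  proof -
    interpret sigma_algebra UNIV "carath_sets \<phi>"
      by (rule sigma_algebra_carath_sets[OF \<phi>(1)])
    obtain H where H: "H \<in> sets borel" "C n \<subseteq> H" "\<phi> H = \<phi> (C n)"
      using \<phi>(2) unfolding borel_regular_def by blast
    have "B \<inter> H \<in> carath_sets \<phi>"
      using \<phi>(2) B(1) H(1) unfolding borel_regular_def by blast
    moreover have "\<phi> (B \<inter> H) < \<infinity>"
      using outer_measure_mono[OF \<phi>(1), of "B \<inter> H" H] H(3) C(2)[of n] by auto
    ultimately obtain K where "K \<in> sets borel" "K \<subseteq> B \<inter> H" "\<phi> (B \<inter> H - K) = 0"
      using borel_inner_approx_finite[OF \<phi>] by blast
    moreover have "\<phi> (B \<inter> C n - K) \<le> \<phi> (B \<inter> H - K)"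
      using H(2) by (intro outer_measure_mono[OF \<phi>(1)]) auto
    ultimately show ?thesis by auto
  qed
  hence "\<forall>n. \<exists>K. K \<in> sets borel \<and> K \<subseteq> B \<and> \<phi> (B \<inter> C n - K) = 0" by blast
  from choice[OF this] obtain K
    where K: "\<And>n. K n \<in> sets borel" "\<And>n. K n \<subseteq> B" "\<And>n. \<phi> (B \<inter> C n - K n) = 0" by blast
  have "\<phi> (B - (\<Union>n. K n)) \<le> \<phi> (\<Union>n. B \<inter> C n - K n)"
    using C(1) by (intro outer_measure_mono[OF \<phi>(1)]) blast
  also have "\<dots> = 0"
    by (rule outer_measure_UN_null[OF \<phi>(1) K(3)])
  finally show ?thesis
    using K by (intro bexI[of _ "\<Union>n. K n"]) auto
qed

text \<open>Induction over the generation of the Borel sets from the open ones. Approximating from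
  inside and outside at once makes the property symmetric under complements, and finiteness of the
  measure gives continuity along decreasing sequences.\<close>

lemma finite_borel_measure_closed_open_approx:
  fixes M :: "'a::metric_space measure"
  assumes borel: "sets borel \<subseteq> sets M" and fin: "emeasure M UNIV < \<infinity>"
    and "B \<in> sets borel" "0 < e"
  shows "\<exists>C V. closed C \<and> open V \<and> C \<subseteq> B \<and> B \<subseteq> V \<and> emeasure M (V - C) < ennreal e"
proof -
  have closed_sets: "C \<in> sets M" if "closed C" for C using borel borel_closed[OF that] by blast
  have open_sets: "V \<in> sets M" if "open V" for V using borel borel_open[OF that] by blast
  have not_top: "emeasure M X \<noteq> \<infinity>" for X
    using le_less_trans[OF emeasure_mono[of X UNIV M] fin] open_sets[of UNIV] by auto
  have "B \<in> sigma_sets UNIV {S. open S}" using \<open>B \<in> sets borel\<close> by (simp add: sets_borel)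
  thus ?thesis using \<open>0 < e\<close>
  proof (induction arbitrary: e rule: sigma_sets.induct)
    case (Basic S)
    hence "open S" by simp
    show ?case
    \<comment> \<open>The whole space is treated apart because \<open>infdist x {} = 0\<close> by
      convention, which would make every \<open>C n\<close> below empty.\<close>
    proof (cases "S = UNIV")
      case True
      thus ?thesis using Basic.prems by (intro exI[of _ UNIV]) auto
    next
      case False
      define C where "C n = {x. inverse (real (Suc n)) \<le> infdist x (- S)}" for n
      have "closed (C n)" for n
        unfolding C_def by (intro closed_Collect_le continuous_intros)
      have sub: "C n \<subseteq> S" for n
      proof
        fix x assume "x \<in> C n"
        show "x \<in> S"
        proof (rule ccontr)
          assume "x \<notin> S"
          hence "infdist x (- S) = 0" by simp
          thus False using \<open>x \<in> C n\<close> by (simp add: C_def)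
        qed
      qed
      have "S - C n \<in> sets M" for n
        using open_sets[OF \<open>open S\<close>] closed_sets[OF \<open>closed (C n)\<close>] by blast
      moreover have "decseq (\<lambda>n. S - C n)"
      proof (rule decseq_SucI, intro Diff_mono order_refl subsetI)
        fix n x assume "x \<in> C n"
        moreover have "inverse (real (Suc (Suc n))) \<le> inverse (real (Suc n))"
          by (intro le_imp_inverse_le) auto
        ultimately show "x \<in> C (Suc n)" unfolding C_def by (blast intro: order_trans)
      qed
      ultimately have "(\<lambda>n. emeasure M (S - C n)) \<longlonglongrightarrow> emeasure M (\<Inter>n. S - C n)"
        using not_top by (intro Lim_emeasure_decseq) auto
      moreover have "(\<Inter>n. S - C n) = {}"
      proof -
        have "\<exists>n. x \<in> C n" if "x \<in> S" for x
        proof -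
          have "0 < infdist x (- S)"
            using that \<open>open S\<close> False
            by (subst infdist_pos_not_in_closed) (auto simp: closed_Compl)
          then obtain n where "inverse (real (Suc n)) < infdist x (- S)"
            using reals_Archimedean by blast
          thus ?thesis unfolding C_def by (blast intro: less_imp_le)
        qed
        thus ?thesis by blast
      qed
      ultimately have "(\<lambda>n. emeasure M (S - C n)) \<longlonglongrightarrow> 0" by (simp only: emeasure_empty)
      hence "eventually (\<lambda>n. emeasure M (S - C n) < ennreal e) sequentially"
        using Basic.prems by (intro order_tendstoD(2)) auto
      then obtain n where "emeasure M (S - C n) < ennreal e"
        by (auto simp: eventually_sequentially)
      thus ?thesis using \<open>closed (C n)\<close> \<open>open S\<close> sub[of n] by blast
    qed
  next
    case Empty
    show ?case using Empty by (intro exI[of _ "{}"]) auto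
  next
    case (Compl S)
    from Compl.IH[OF Compl.prems] obtain C V where
      "closed C" "open V" "C \<subseteq> S" "S \<subseteq> V" "emeasure M (V - C) < ennreal e" by blast
    moreover have "- C - - V = V - C" by blast
    ultimately show ?case
      by (intro exI[of _ "- V"] exI[of _ "- C"]) auto
  next
    case (Union S)
    \<comment> \<open>The errors add up to \<open>e/2\<close>, which leaves a strict inequality
      below \<open>e\<close>. By continuity it persists for some finite union of the
      \<open>C n\<close>; the infinite union need not be closed.\<close>
    define r where "r n = e/2 * (1/2)^Suc n" for n
    have "0 < r n" for n using Union.prems by (simp add: r_def)
    from Union.IH[OF this] have "\<forall>n. \<exists>C V. closed C \<and> open V \<and> C \<subseteq> S n \<and> S n \<subseteq> V \<and>
        emeasure M (V - C) < ennreal (r n)" ..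
    from choice[OF this] obtain C where "\<forall>n. \<exists>V. closed (C n) \<and> open V \<and> C n \<subseteq> S n \<and> S n \<subseteq> V \<and>
        emeasure M (V - C n) < ennreal (r n)" ..
    from choice[OF this] obtain V where CV: "\<And>n. closed (C n)" "\<And>n. open (V n)"
      "\<And>n. C n \<subseteq> S n" "\<And>n. S n \<subseteq> V n" "\<And>n. emeasure M (V n - C n) < ennreal (r n)" by blast
    have VC: "range V \<subseteq> sets M" "range C \<subseteq> sets M" "range (\<lambda>n. V n - C n) \<subseteq> sets M"
      using CV(1,2) open_sets closed_sets by (blast intro: sets.Diff)+
    have "emeasure M ((\<Union>n. V n) - (\<Union>n. C n)) \<le> emeasure M (\<Union>n. V n - C n)"
      using VC(3) by (intro emeasure_mono sets.countable_UN) auto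
    also have "\<dots> \<le> (\<Sum>n. emeasure M (V n - C n))"
      using VC(3) by (rule emeasure_subadditive_countably)
    also have "\<dots> \<le> (\<Sum>n. ennreal (r n))"
      using CV(5) by (intro suminf_le summableI allI less_imp_le)
    also have "\<dots> = ennreal (e/2)"
      using Union.prems sums_mult[OF power_half_series, of "e/2"]
      unfolding r_def by (intro suminf_ennreal_eq) auto
    also have "\<dots> < ennreal e" using Union.prems by (simp add: ennreal_less_iff)
    finally have lt: "emeasure M ((\<Union>n. V n) - (\<Union>n. C n)) < ennreal e" .
    have "(\<lambda>N. emeasure M ((\<Union>n. V n) - (\<Union>n<N. C n))) \<longlonglongrightarrow>
        emeasure M (\<Inter>N. (\<Union>n. V n) - (\<Union>n<N. C n))"
    proof (rule Lim_emeasure_decseq)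
      show "range (\<lambda>N. (\<Union>n. V n) - (\<Union>n<N. C n)) \<subseteq> sets M"
        using VC(1,2) by auto
      show "decseq (\<lambda>N. (\<Union>n. V n) - (\<Union>n<N. C n))"
        by (rule decseq_SucI) (auto simp: less_Suc_eq)
    qed (use not_top in auto)
    moreover have "(\<Inter>N. (\<Union>n. V n) - (\<Union>n<N. C n)) = (\<Union>n. V n) - (\<Union>n. C n)"
      by auto
    ultimately have "eventually (\<lambda>N. emeasure M ((\<Union>n. V n) - (\<Union>n<N. C n)) < ennreal e) sequentially"
      using lt by (intro order_tendstoD(2)) auto
    then obtain N where "emeasure M ((\<Union>n. V n) - (\<Union>n<N. C n)) < ennreal e"
      by (auto simp: eventually_sequentially)
    moreover have "closed (\<Union>n<N. C n)" "open (\<Union>n. V n)"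
      using CV(1,2) by auto
    ultimately show ?case
      using CV(3,4) by (intro exI[of _ "\<Union>n<N. C n"] exI[of _ "\<Union>n. V n"] conjI) blast+
  qed
qed

text \<open>On each \<open>U n\<close> the measure is finite, so a Borel set can be approximated
  there from outside by open sets. Excess is measured against a Borel hull \<open>H\<close> of
  \<open>E\<close>, since \<open>E\<close> itself need not be measurable, and the errors
  \<open>e / 2 ^ (n + 1)\<close> sum to \<open>e\<close>.\<close>

lemma open_outer_approx:
  fixes \<mu> :: "'a::metric_space set \<Rightarrow> ennreal"
  assumes \<mu>: "measure_over \<mu>" "borel_regular \<mu>"
    and U: "\<And>n::nat. open (U n)" "\<And>n. \<mu> (U n) < \<infinity>" "E \<subseteq> (\<Union>n. U n)"
    and "0 < e"
  shows "\<exists>V. open V \<and> E \<subseteq> V \<and> \<mu> V \<le> \<mu> E + ennreal e"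
proof -
  obtain H where H: "H \<in> sets borel" "E \<subseteq> H" "\<mu> H = \<mu> E"
    using \<mu>(2) unfolding borel_regular_def by blast
  have borel: "X \<in> carath_sets \<mu>" if "X \<in> sets borel" for X
    using \<mu>(2) that unfolding borel_regular_def by blast
  have "\<exists>V. open V \<and> H \<inter> U n \<subseteq> V \<and> \<mu> (U n \<inter> V - H) \<le> ennreal (e * (1/2)^Suc n)" for n
  proof -
    \<comment> \<open>The density with respect to an indicator is the restriction of
      \<open>\<mu>\<close> to \<open>U n\<close>, a finite measure whose measurable sets include all
      Borel sets.\<close>
    define M where "M = density (carath_measure \<mu>) (indicator (U n))"
    have M: "emeasure M X = \<mu> (U n \<inter> X)" if "X \<in> sets borel" for X
    proof -
      have "U n \<in> sets borel" using U(1) by simp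
      moreover from this have "U n \<inter> X \<in> sets borel" using that by blast
      ultimately show ?thesis
        using borel that unfolding M_def
        by (subst emeasure_restricted) (simp_all add: sets_carath_measure emeasure_carath_measure \<mu>(1))
    qed
    have "\<exists>C V. closed C \<and> open V \<and> C \<subseteq> H \<inter> U n \<and> H \<inter> U n \<subseteq> V \<and>
        emeasure M (V - C) < ennreal (e * (1/2)^Suc n)"
    proof (rule finite_borel_measure_closed_open_approx)
      show "sets borel \<subseteq> sets M" using borel by (auto simp: M_def sets_carath_measure[OF \<mu>(1)])
      show "emeasure M UNIV < \<infinity>" using U(2) by (simp add: M)
      show "H \<inter> U n \<in> sets borel" using H(1) U(1) by auto
      show "0 < e * (1/2)^Suc n" using \<open>0 < e\<close> by simp
    qed
    then obtain C V where CV: "closed C" "open V" "C \<subseteq> H \<inter> U n" "H \<inter> U n \<subseteq> V"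
      "emeasure M (V - C) < ennreal (e * (1/2)^Suc n)" by blast
    have "\<mu> (U n \<inter> V - H) \<le> \<mu> (U n \<inter> (V - C))"
      using CV(3) by (intro outer_measure_mono[OF \<mu>(1)]) auto
    also have "\<dots> = emeasure M (V - C)"
      using CV(1,2) by (intro M[symmetric]) auto
    finally show ?thesis using CV by (intro exI[of _ V]) auto
  qed
  hence "\<forall>n. \<exists>V. open V \<and> H \<inter> U n \<subseteq> V \<and> \<mu> (U n \<inter> V - H) \<le> ennreal (e * (1/2)^Suc n)" ..
  from choice[OF this] obtain V where V: "\<And>n. open (V n)" "\<And>n. H \<inter> U n \<subseteq> V n"
    "\<And>n. \<mu> (U n \<inter> V n - H) \<le> ennreal (e * (1/2)^Suc n)" by blast
  have "\<mu> (\<Union>n. U n \<inter> V n) \<le> \<mu> (H \<union> (\<Union>n. U n \<inter> V n - H))"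
    by (intro outer_measure_mono[OF \<mu>(1)]) auto
  also have "\<dots> \<le> \<mu> H + \<mu> (\<Union>n. U n \<inter> V n - H)"
    by (rule outer_measure_Un[OF \<mu>(1)])
  also have "\<dots> \<le> \<mu> H + (\<Sum>n. \<mu> (U n \<inter> V n - H))"
    by (intro add_left_mono outer_measure_UN[OF \<mu>(1)])
  also have "\<dots> \<le> \<mu> H + (\<Sum>n. ennreal (e * (1/2)^Suc n))"
    by (intro add_left_mono suminf_le summableI allI V(3))
  also have "(\<Sum>n. ennreal (e * (1/2)^Suc n)) = ennreal e"
    using \<open>0 < e\<close> sums_mult[OF power_half_series, of e] by (intro suminf_ennreal_eq) auto
  finally have "\<mu> (\<Union>n. U n \<inter> V n) \<le> \<mu> E + ennreal e" by (simp add: H(3))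
  moreover have "E \<subseteq> (\<Union>n. U n \<inter> V n)"
  proof
    fix x assume "x \<in> E"
    then obtain n where "x \<in> H \<inter> U n" using H(2) U(3) by blast
    thus "x \<in> (\<Union>n. U n \<inter> V n)" using V(2)[of n] by blast
  qed
  moreover have "open (\<Union>n. U n \<inter> V n)"
    using U(1) V(1) by (intro open_UN ballI open_Int)
  ultimately show ?thesis by blast
qed

section \<open>Density estimates\<close>

text \<open>Zorn's lemma on disjoint subfamilies that already serve every set they meet. If a
  maximal one missed some members of \<open>\<F>\<close>, a missed set whose size is maximal up to
  the factor \<open>\<tau>\<close> could be added, because it serves all missed sets it
  meets.\<close>

lemma vitali_disjoint_subfamily:
  fixes \<delta> :: "'a set \<Rightarrow> ennreal" and \<tau> :: real
  assumes ne: "\<And>S. S \<in> \<F> \<Longrightarrow> S \<noteq> {}" and bound: "\<And>S. S \<in> \<F> \<Longrightarrow> \<delta> S \<le> b" "b < \<infinity>" and "1 < \<tau>"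
  obtains \<G> where "\<G> \<subseteq> \<F>" "disjoint \<G>"
    "\<And>S. S \<in> \<F> \<Longrightarrow> \<exists>T\<in>\<G>. S \<inter> T \<noteq> {} \<and> \<delta> S \<le> ennreal \<tau> * \<delta> T"
proof -
  define \<Omega> where "\<Omega> = {\<H>. \<H> \<subseteq> \<F> \<and> disjoint \<H> \<and>
    (\<forall>S\<in>\<F>. (\<exists>T\<in>\<H>. S \<inter> T \<noteq> {}) \<longrightarrow> (\<exists>T\<in>\<H>. S \<inter> T \<noteq> {} \<and> \<delta> S \<le> ennreal \<tau> * \<delta> T))}"
  have "\<Union>\<C> \<in> \<Omega>" if "\<C> \<in> chains \<Omega>" for \<C>
  proof -
    have "disjoint (\<Union>\<C>)"
      using that by (intro pairwise_chain_Union) (auto simp: chains_def \<Omega>_def)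
    moreover have "\<C> \<subseteq> \<Omega>" using that by (simp add: chainsD2)
    have "\<Union>\<C> \<subseteq> \<F>"
    proof (rule Union_least)
      fix \<H> assume "\<H> \<in> \<C>"
      with \<open>\<C> \<subseteq> \<Omega>\<close> have "\<H> \<in> \<Omega>" ..
      thus "\<H> \<subseteq> \<F>" by (simp add: \<Omega>_def)
    qed
    moreover have "\<exists>T\<in>\<Union>\<C>. S \<inter> T \<noteq> {} \<and> \<delta> S \<le> ennreal \<tau> * \<delta> T"
      if S: "S \<in> \<F>" "\<exists>T\<in>\<Union>\<C>. S \<inter> T \<noteq> {}" for S
    proof -
      obtain \<H> where "\<H> \<in> \<C>" "\<exists>T\<in>\<H>. S \<inter> T \<noteq> {}" using S(2) by blast
      moreover have "\<H> \<in> \<Omega>" using \<open>\<H> \<in> \<C>\<close> \<open>\<C> \<subseteq> \<Omega>\<close> ..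
      ultimately have "\<exists>T\<in>\<H>. S \<inter> T \<noteq> {} \<and> \<delta> S \<le> ennreal \<tau> * \<delta> T"
        using S(1) unfolding \<Omega>_def by simp
      thus ?thesis using \<open>\<H> \<in> \<C>\<close> by blast
    qed
    ultimately show ?thesis unfolding \<Omega>_def by simp
  qed
  from Zorn_Lemma[OF ballI[OF this]] obtain \<G>
    where "\<G> \<in> \<Omega>" and max: "\<And>\<H>. \<H> \<in> \<Omega> \<Longrightarrow> \<G> \<subseteq> \<H> \<Longrightarrow> \<H> = \<G>" by blast
  hence \<G>: "\<G> \<subseteq> \<F>" "disjoint \<G>" "\<And>S. S \<in> \<F> \<Longrightarrow> \<exists>T\<in>\<G>. S \<inter> T \<noteq> {} \<Longrightarrow>
    \<exists>T\<in>\<G>. S \<inter> T \<noteq> {} \<and> \<delta> S \<le> ennreal \<tau> * \<delta> T"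
    by (auto simp: \<Omega>_def)
  define \<K> where "\<K> = {S\<in>\<F>. \<forall>T\<in>\<G>. S \<inter> T = {}}"
  have "\<K> = {}"
  proof (rule ccontr)
    assume "\<K> \<noteq> {}"
    define s where "s = (SUP S\<in>\<K>. \<delta> S)"
    have "s \<le> b" unfolding s_def using bound(1) by (intro SUP_least) (auto simp: \<K>_def)
    \<comment> \<open>Finiteness of \<open>b\<close> and \<open>\<tau> > 1\<close> make
      \<open>\<tau> * s\<close> strictly larger than a nonzero \<open>s\<close>, so some missed set
      attains the supremum up to \<open>\<tau>\<close>.\<close>
    have "\<exists>T\<in>\<K>. s \<le> ennreal \<tau> * \<delta> T"
    proof (cases "s = 0")
      case True
      thus ?thesis using \<open>\<K> \<noteq> {}\<close> by auto
    next
      case False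
      have "s < ennreal \<tau> * s"
        using False \<open>s \<le> b\<close> \<open>b < \<infinity>\<close> \<open>1 < \<tau>\<close>
        by (cases s) (auto simp: ennreal_less_iff top_unique simp flip: ennreal_mult)
      also have "ennreal \<tau> * s = (SUP S\<in>\<K>. ennreal \<tau> * \<delta> S)"
        by (simp add: s_def SUP_mult_left_ennreal)
      finally show ?thesis by (auto simp: less_SUP_iff intro: less_imp_le)
    qed
    then obtain T where T: "T \<in> \<K>" "s \<le> ennreal \<tau> * \<delta> T" by blast
    have "insert T \<G> \<in> \<Omega>"
      unfolding \<Omega>_def
    proof (intro CollectI conjI ballI impI)
      show "insert T \<G> \<subseteq> \<F>" "disjoint (insert T \<G>)"
        using \<G>(1,2) T(1) by (auto simp: \<K>_def pairwise_insert disjnt_def)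
      fix S assume S: "S \<in> \<F>" "\<exists>T'\<in>insert T \<G>. S \<inter> T' \<noteq> {}"
      show "\<exists>T'\<in>insert T \<G>. S \<inter> T' \<noteq> {} \<and> \<delta> S \<le> ennreal \<tau> * \<delta> T'"
      proof (cases "\<exists>T'\<in>\<G>. S \<inter> T' \<noteq> {}")
        case True
        thus ?thesis using \<G>(3) S(1) by blast
      next
        case False
        hence "S \<in> \<K>" using S(1) by (auto simp: \<K>_def)
        hence "\<delta> S \<le> s" unfolding s_def by (rule SUP_upper)
        thus ?thesis using False S(2) T(2) by auto
      qed
    qed
    hence "T \<in> \<G>" using max[of "insert T \<G>"] by blast
    thus False using T(1) ne by (auto simp: \<K>_def)
  qed
  hence "\<exists>T\<in>\<G>. S \<inter> T \<noteq> {} \<and> \<delta> S \<le> ennreal \<tau> * \<delta> T" if "S \<in> \<F>" for S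
    using \<G>(3)[OF that] that by (auto simp: \<K>_def)
  thus ?thesis using that \<G>(1,2) by blast
qed


text \<open>Continuity from below holds for arbitrary sets when the outer measure is regular. Borel
  hulls \<open>H n\<close> of the \<open>E n\<close> need not increase, but the intersections of
  \<open>H m\<close> over \<open>m \<ge> n\<close> do, still contain \<open>E n\<close>, and have no
  larger measure than \<open>H n\<close>.\<close>

lemma borel_regular_incseq_le:
  assumes \<phi>: "measure_over \<phi>" "borel_regular \<phi>"
    and "incseq E" and le: "\<And>n. \<phi> (E n) \<le> x"
  shows "\<phi> (\<Union>n. E n) \<le> x"
proof -
  have "\<forall>n. \<exists>H. H \<in> sets borel \<and> E n \<subseteq> H \<and> \<phi> H = \<phi> (E n)"
    using \<phi>(2) unfolding borel_regular_def by blast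
  from choice[OF this] obtain H where H: "\<And>n. H n \<in> sets borel" "\<And>n. E n \<subseteq> H n"
    "\<And>n. \<phi> (H n) = \<phi> (E n)" by blast
  define G where "G n = (\<Inter>m\<in>{n..}. H m)" for n
  have G: "G n \<in> carath_sets \<phi>" for n
  proof -
    have "G n \<in> sets borel" unfolding G_def using H(1) by (intro sets.countable_INT'') auto
    thus ?thesis using \<phi>(2) unfolding borel_regular_def by blast
  qed
  have EG: "E n \<subseteq> G n" for n
    unfolding G_def using H(2) monoD[OF \<open>incseq E\<close>] by (fastforce simp: subset_iff)
  have "\<phi> (\<Union>n. E n) \<le> \<phi> (\<Union>n. G n)"
    using EG by (intro outer_measure_mono[OF \<phi>(1)]) blast
  also have "\<dots> = emeasure (carath_measure \<phi>) (\<Union>n. G n)"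
    using G sets.countable_UN[of G UNIV "carath_measure \<phi>"]
    by (intro emeasure_carath_measure[symmetric]) (auto simp: sets_carath_measure \<phi>(1))
  also have "\<dots> = (SUP n. emeasure (carath_measure \<phi>) (G n))"
  proof (rule SUP_emeasure_incseq[symmetric])
    show "range G \<subseteq> sets (carath_measure \<phi>)" using G by (auto simp: sets_carath_measure \<phi>(1))
    show "incseq G" by (auto simp: incseq_def G_def)
  qed
  also have "\<dots> \<le> x"
  proof (rule SUP_least)
    fix n
    have "\<phi> (G n) \<le> \<phi> (H n)" by (intro outer_measure_mono[OF \<phi>(1)]) (auto simp: G_def)
    thus "emeasure (carath_measure \<phi>) (G n) \<le> x"
      using G[of n] H(3)[of n] le[of n] by (auto simp: emeasure_carath_measure \<phi>(1))
  qed
  finally show ?thesis .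
qed

text \<open>A set excluded from the admissible class has both values 0 or both infinite, and then
  the inequality holds for every \<open>t > 0\<close>. Hence arbitrary covers from
  \<open>\<S>\<close> can be used in the upper estimate.\<close>

lemma le_mult_of_quotient_fun_le:
  assumes "S \<in> \<S>" "0 < t" and Q: "S \<in> admissible \<S> \<mu> \<zeta> \<Longrightarrow> quotient_fun \<mu> \<zeta> S \<le> ennreal t"
  shows "\<mu> S \<le> ennreal t * \<zeta> S"
proof (cases "S \<in> admissible \<S> \<mu> \<zeta>")
  case True
  have "\<mu> S \<le> ennreal t * \<zeta> S" if "\<zeta> S \<noteq> 0" "\<zeta> S \<noteq> \<infinity>"
  proof -
    have "\<mu> S = \<mu> S / \<zeta> S * \<zeta> S"
      using that by (simp add: ennreal_divide_times ennreal_divide_self less_top)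
    also have "\<dots> \<le> ennreal t * \<zeta> S"
      using Q[OF True] that by (intro mult_right_mono) (auto simp: quotient_fun_def)
    finally show ?thesis .
  qed
  thus ?thesis
    using Q[OF True] \<open>0 < t\<close>
    by (cases "\<zeta> S = 0"; cases "\<zeta> S = \<infinity>") (auto simp: quotient_fun_def ennreal_mult_top top_unique)
next
  case False
  thus ?thesis using assms(1,2) by (auto simp: admissible_def ennreal_mult_top)
qed

text \<open>The strict bound rules out an infinite gauge, where the quotient is 0. At gauge 0
  admissibility supplies \<open>\<mu> S > 0\<close>; this positivity is what later makes disjoint
  families of such sets countable.\<close>

lemma mult_le_of_less_quotient_fun:
  assumes "S \<in> admissible \<S> \<mu> \<zeta>" "ennreal t < quotient_fun \<mu> \<zeta> S"
  shows "ennreal t * \<zeta> S \<le> \<mu> S" "0 < \<mu> S"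
proof -
  have *: "\<zeta> S \<noteq> \<infinity>" using assms(2) by (auto simp: quotient_fun_def)
  show "ennreal t * \<zeta> S \<le> \<mu> S"
  proof (cases "\<zeta> S = 0")
    case False
    have "ennreal t * \<zeta> S \<le> \<mu> S / \<zeta> S * \<zeta> S"
      using assms(2) False * by (intro mult_right_mono) (auto simp: quotient_fun_def)
    also have "\<dots> = \<mu> S"
      using False * by (simp add: ennreal_divide_times ennreal_divide_self less_top)
    finally show ?thesis .
  qed simp
  show "0 < \<mu> S"
    using assms * by (cases "\<mu> S = 0") (auto simp: quotient_fun_def admissible_def zero_less_iff_neq_zero split: if_splits)
qed

text \<open>The scale below which the quotients stay under \<open>t\<close> depends on the point. On
  \<open>D n\<close> the single scale \<open>1 / (n + 1)\<close> works for all points; these sets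
  increase to \<open>E\<close> and may be nonmeasurable, which is why the limit goes through Borel
  hulls.\<close>

lemma measure_le_of_federer_density_less:
  assumes \<mu>: "measure_over \<mu>" "borel_regular \<mu>" and "0 < t"
    and F: "\<And>x. x \<in> E \<Longrightarrow> federer_density \<S> \<zeta> \<mu> x < ennreal t"
  shows "\<mu> E \<le> ennreal t * carath_psi \<S> \<zeta> E"
proof -
  define D where "D n = {x\<in>E. \<forall>S\<in>admissible \<S> \<mu> \<zeta>. x \<in> S \<longrightarrow> ediam S < ennreal (inverse (real (Suc n))) \<longrightarrow>
    quotient_fun \<mu> \<zeta> S \<le> ennreal t}" for n
  have "E \<subseteq> (\<Union>n. D n)"
  proof
    fix x assume "x \<in> E"
    from F[OF this] obtain \<epsilon> where \<epsilon>: "0 < \<epsilon>"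
      "(SUP S\<in>{S \<in> admissible \<S> \<mu> \<zeta>. x \<in> S \<and> ediam S < ennreal \<epsilon>}. quotient_fun \<mu> \<zeta> S) < ennreal t"
      by (auto simp: federer_density_def INF_less_iff)
    obtain n where n: "inverse (real (Suc n)) < \<epsilon>" using reals_Archimedean[OF \<epsilon>(1)] ..
    have "quotient_fun \<mu> \<zeta> S \<le> ennreal t"
      if S: "S \<in> admissible \<S> \<mu> \<zeta>" "x \<in> S" "ediam S < ennreal (inverse (real (Suc n)))" for S
    proof -
      have "ediam S < ennreal \<epsilon>"
        using S(3) n by (meson ennreal_leI less_imp_le less_le_trans)
      hence "quotient_fun \<mu> \<zeta> S \<le> (SUP S\<in>{S \<in> admissible \<S> \<mu> \<zeta>. x \<in> S \<and> ediam S < ennreal \<epsilon>}. quotient_fun \<mu> \<zeta> S)"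
        using S(1,2) by (intro SUP_upper) auto
      thus ?thesis using \<epsilon>(2) by (rule order_trans[OF _ less_imp_le])
    qed
    thus "x \<in> (\<Union>n. D n)" using \<open>x \<in> E\<close> unfolding D_def by blast
  qed
  hence "\<mu> E \<le> \<mu> (\<Union>n. D n)" by (rule outer_measure_mono[OF \<mu>(1)])
  also have "\<dots> \<le> ennreal t * carath_psi \<S> \<zeta> E"
  proof (rule borel_regular_incseq_le[OF \<mu>])
    show "incseq D"
    proof (rule incseq_SucI, rule subsetI)
      fix n x assume "x \<in> D n"
      moreover have "ennreal (inverse (real (Suc (Suc n)))) \<le> ennreal (inverse (real (Suc n)))"
        by (intro ennreal_leI le_imp_inverse_le) auto
      ultimately show "x \<in> D (Suc n)" unfolding D_def by (blast intro: less_le_trans)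
    qed
    fix n
    \<comment> \<open>Covers have diameter at most \<open>\<delta>\<close>, while \<open>D n\<close>
      demands a strict bound by \<open>1 / (n + 1)\<close>; the next reciprocal leaves the needed
      room.\<close>
    define \<delta> where "\<delta> = inverse (real (Suc (Suc n)))"
    have "0 < \<delta>" "\<delta> < inverse (real (Suc n))"
      unfolding \<delta>_def by (simp, intro less_imp_inverse_less) auto
    have "inverse (ennreal t) * \<mu> (D n) \<le> carath_approx \<S> \<zeta> \<delta> (D n)"
    proof (rule le_carath_approx)
      fix J C
      assume JC: "\<And>j::nat. j \<in> J \<Longrightarrow> C j \<in> \<S>" "\<And>j. j \<in> J \<Longrightarrow> ediam (C j) \<le> ennreal \<delta>"
        "D n \<subseteq> (\<Union>j\<in>J. C j)"
      have "\<mu> (D n) \<le> \<mu> (\<Union>j. if j \<in> J then D n \<inter> C j else {})"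
        using JC(3) by (intro outer_measure_mono[OF \<mu>(1)]) (auto split: if_splits)
      also have "\<dots> \<le> (\<Sum>j. \<mu> (if j \<in> J then D n \<inter> C j else {}))"
        by (rule outer_measure_UN[OF \<mu>(1)])
      also have "\<dots> \<le> (\<Sum>j. ennreal t * (if j \<in> J then \<zeta> (C j) else 0))"
      proof (intro suminf_le summableI allI)
        fix j
        show "\<mu> (if j \<in> J then D n \<inter> C j else {}) \<le> ennreal t * (if j \<in> J then \<zeta> (C j) else 0)"
        \<comment> \<open>A member that misses \<open>D n\<close> contributes nothing; in any other
          one a point of \<open>D n\<close> supplies the bound on the quotient.\<close>
        proof (cases "j \<in> J \<and> D n \<inter> C j \<noteq> {}")
          case True
          then obtain x where x: "j \<in> J" "x \<in> D n" "x \<in> C j" by blast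
          have "ediam (C j) < ennreal (inverse (real (Suc n)))"
            using JC(2)[OF x(1)] \<open>0 < \<delta>\<close> \<open>\<delta> < inverse (real (Suc n))\<close>
            by (meson ennreal_less_iff le_less_trans less_imp_le)
          hence "\<mu> (C j) \<le> ennreal t * \<zeta> (C j)"
            using x JC(1)[OF x(1)] \<open>0 < t\<close>
            by (intro le_mult_of_quotient_fun_le) (auto simp: D_def)
          moreover have "\<mu> (D n \<inter> C j) \<le> \<mu> (C j)" by (intro outer_measure_mono[OF \<mu>(1)]) auto
          ultimately show ?thesis using x(1) by simp
        qed (auto simp: outer_measure_zero[OF \<mu>(1)])
      qed
      finally have "\<mu> (D n) \<le> ennreal t * (\<Sum>j. if j \<in> J then \<zeta> (C j) else 0)" by simp
      hence "inverse (ennreal t) * \<mu> (D n) \<le>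
          inverse (ennreal t) * (ennreal t * (\<Sum>j. if j \<in> J then \<zeta> (C j) else 0))"
        by (rule mult_left_mono) simp
      also have "inverse (ennreal t) * ennreal t = 1"
        using \<open>0 < t\<close> by (simp add: inverse_ennreal flip: ennreal_mult)
      hence "inverse (ennreal t) * (ennreal t * (\<Sum>j. if j \<in> J then \<zeta> (C j) else 0)) =
          (\<Sum>j. if j \<in> J then \<zeta> (C j) else 0)"
        by (metis mult.assoc mult_1)
      finally show "inverse (ennreal t) * \<mu> (D n) \<le> (\<Sum>j. if j \<in> J then \<zeta> (C j) else 0)" .
    qed
    also have "\<dots> \<le> carath_psi \<S> \<zeta> (D n)" using \<open>0 < \<delta>\<close> by (rule carath_approx_le_psi)
    also have "\<dots> \<le> carath_psi \<S> \<zeta> E"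
      by (intro outer_measure_mono[OF measure_over_carath_psi]) (auto simp: D_def)
    finally have "ennreal t * (inverse (ennreal t) * \<mu> (D n)) \<le> ennreal t * carath_psi \<S> \<zeta> E"
      by (rule mult_left_mono) simp
    moreover have "ennreal t * inverse (ennreal t) = 1"
      using \<open>0 < t\<close> by (simp add: inverse_ennreal flip: ennreal_mult)
    ultimately show "\<mu> (D n) \<le> ennreal t * carath_psi \<S> \<zeta> E"
      by (metis mult.assoc mult_1)
  qed
  finally show ?thesis .
qed

lemma less_federer_densityE:
  assumes "ennreal t < federer_density \<S> \<zeta> \<mu> x" "0 < \<epsilon>"
  obtains S where "S \<in> admissible \<S> \<mu> \<zeta>" "x \<in> S" "ediam S < ennreal \<epsilon>" "ennreal t < quotient_fun \<mu> \<zeta> S"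
proof -
  have "ennreal t < (SUP S\<in>{S \<in> admissible \<S> \<mu> \<zeta>. x \<in> S \<and> ediam S < ennreal \<epsilon>}. quotient_fun \<mu> \<zeta> S)"
    using less_INF_D[OF assms(1)[unfolded federer_density_def]] assms(2) by simp
  thus thesis using that by (auto simp: less_SUP_iff)
qed

section \<open>Disjoint families of measurable sets and the lower estimate\<close>

lemma suminf_disjoint_le:
  fixes S :: "nat \<Rightarrow> 'a set"
  assumes \<mu>: "measure_over \<mu>"
    and "\<And>n. S n \<in> carath_sets \<mu>" "disjoint_family S" "\<And>n. S n \<subseteq> V"
  shows "(\<Sum>n. \<mu> (S n)) \<le> \<mu> V"
proof -
  have S: "range S \<subseteq> sets (carath_measure \<mu>)"
    using assms(2) by (auto simp: sets_carath_measure[OF \<mu>])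
  have "(\<Sum>n. \<mu> (S n)) = (\<Sum>n. emeasure (carath_measure \<mu>) (S n))"
    using assms(2) by (simp add: emeasure_carath_measure[OF \<mu>])
  also have "\<dots> = emeasure (carath_measure \<mu>) (\<Union>n. S n)"
    by (rule suminf_emeasure[OF S assms(3)])
  also have "\<dots> = \<mu> (\<Union>n. S n)"
    using sets.countable_UN[OF S] by (intro emeasure_carath_measure[OF \<mu>]) (simp add: sets_carath_measure[OF \<mu>])
  also have "\<dots> \<le> \<mu> V"
    using assms(4) by (intro outer_measure_mono[OF \<mu>]) auto
  finally show ?thesis .
qed

text \<open>Finite subfamilies have total measure at most \<open>\<mu> V\<close>, so the measures
  are summable over the family and only countably many can be nonzero. Countability is thus drawn
  from the measure and not from separability of the space.\<close>

lemma countable_disjoint_positive: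
  assumes \<mu>: "measure_over \<mu>"
    and \<G>: "\<And>S. S \<in> \<G> \<Longrightarrow> S \<in> carath_sets \<mu>" "disjoint \<G>" "\<And>S. S \<in> \<G> \<Longrightarrow> S \<subseteq> V" "\<And>S. S \<in> \<G> \<Longrightarrow> 0 < \<mu> S"
    and fin: "\<mu> V < \<infinity>"
  shows "countable \<G>"
proof -
  have fin_S: "\<mu> S < \<infinity>" if "S \<in> \<G>" for S
    using outer_measure_mono[OF \<mu> \<G>(3)[OF that]] fin by (rule le_less_trans)
  have "(\<lambda>S. enn2real (\<mu> S)) summable_on \<G>"
  proof (rule nonneg_bdd_above_summable_on)
    show "bdd_above (sum (\<lambda>S. enn2real (\<mu> S)) ` {\<H>. \<H> \<subseteq> \<G> \<and> finite \<H>})"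
    proof (rule bdd_aboveI2)
      fix \<H> assume "\<H> \<in> {\<H>. \<H> \<subseteq> \<G> \<and> finite \<H>}"
      hence \<H>: "\<H> \<subseteq> \<G>" "finite \<H>" by auto
      have sets: "S \<in> sets (carath_measure \<mu>)" if "S \<in> \<H>" for S
        using \<G>(1) \<H>(1) that by (auto simp: sets_carath_measure[OF \<mu>])
      have "(\<Sum>S\<in>\<H>. \<mu> S) = (\<Sum>S\<in>\<H>. emeasure (carath_measure \<mu>) S)"
        using \<G>(1) \<H>(1) by (intro sum.cong) (auto simp: emeasure_carath_measure[OF \<mu>])
      also have "\<dots> = emeasure (carath_measure \<mu>) (\<Union>S\<in>\<H>. S)"
      proof (rule sum_emeasure)
        show "disjoint_family_on (\<lambda>S. S) \<H>"
          using \<G>(2) \<H>(1) by (auto simp: disjoint_family_on_def disjoint_def)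
      qed (use sets \<H>(2) in auto)
      also have "\<dots> = \<mu> (\<Union>S\<in>\<H>. S)"
        using sets.finite_UN[where A = "\<lambda>S. S", OF \<H>(2) sets] by (intro emeasure_carath_measure[OF \<mu>]) (simp add: sets_carath_measure[OF \<mu>])
      also have "\<dots> \<le> \<mu> V" using \<G>(3) \<H>(1) by (intro outer_measure_mono[OF \<mu>]) auto
      finally have "enn2real (\<Sum>S\<in>\<H>. \<mu> S) \<le> enn2real (\<mu> V)"
        using fin by (intro enn2real_mono) auto
      moreover have "enn2real (\<Sum>S\<in>\<H>. \<mu> S) = (\<Sum>S\<in>\<H>. enn2real (\<mu> S))"
        using fin_S \<H>(1) enn2real_sum[of \<H> \<mu>] by (auto simp: o_def)
      ultimately show "(\<Sum>S\<in>\<H>. enn2real (\<mu> S)) \<le> enn2real (\<mu> V)" by simp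
    qed
  qed simp
  hence "countable {S\<in>\<G>. enn2real (\<mu> S) \<noteq> 0}" by (rule summable_countable_real)
  moreover have "{S\<in>\<G>. enn2real (\<mu> S) \<noteq> 0} = \<G>"
    using fin_S \<G>(4) by (force simp: enn2real_eq_0_iff)
  ultimately show ?thesis by simp
qed

lemma mult_psi_le_open_of_less_federer_density:
  fixes \<mu> \<zeta> :: "'a::metric_space set \<Rightarrow> ennreal" and c \<eta> \<tau> t :: real
  assumes \<mu>: "measure_over \<mu>" "borel_regular \<mu>"
    and closed: "\<And>S. S \<in> admissible \<S> \<mu> \<zeta> \<Longrightarrow> closed S"
    and "1 < \<tau>" "1 \<le> c" "0 < \<eta>"
    and encl: "\<And>S. S \<in> admissible \<S> \<mu> \<zeta> \<Longrightarrow> \<exists>S'\<in>\<S>. enlargement \<S> \<mu> \<zeta> \<tau> S \<subseteq> S' \<and>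
              ediam S' \<le> ennreal c * ediam S \<and> \<zeta> S' \<le> ennreal \<eta> * \<zeta> S"
    and V: "open V" "E \<subseteq> V" "\<mu> V < \<infinity>"
    and "0 < t" and F: "\<And>x. x \<in> E \<Longrightarrow> ennreal t < federer_density \<S> \<zeta> \<mu> x"
  shows "ennreal t * carath_psi \<S> \<zeta> E \<le> \<mu> V"
proof -
  have approx: "ennreal t * carath_approx \<S> \<zeta> \<delta> E \<le> \<mu> V" if "0 < \<delta>" for \<delta>
  proof -
    \<comment> \<open>The enclosing sets may be wider by the factor \<open>c\<close>; selecting at
      scale \<open>\<delta> / c\<close> keeps them admissible as members of a cover with mesh
      \<open>\<delta>\<close>.\<close>
    define \<epsilon> where "\<epsilon> = \<delta> / c"
    have "0 < \<epsilon>" "\<epsilon> \<le> \<delta>" "c * \<epsilon> = \<delta>"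
      using \<open>0 < \<delta>\<close> \<open>1 \<le> c\<close> by (auto simp: \<epsilon>_def field_simps)
    define \<F> where "\<F> = {S \<in> admissible \<S> \<mu> \<zeta>. S \<noteq> {} \<and> S \<subseteq> V \<and> ediam S < ennreal \<epsilon> \<and>
      ennreal t < quotient_fun \<mu> \<zeta> S}"
    obtain \<G> where \<G>: "\<G> \<subseteq> \<F>" "disjoint \<G>"
      "\<And>S. S \<in> \<F> \<Longrightarrow> \<exists>T\<in>\<G>. S \<inter> T \<noteq> {} \<and> ediam S \<le> ennreal \<tau> * ediam T"
      by (rule vitali_disjoint_subfamily[of \<F> ediam "ennreal \<epsilon>" \<tau>])
        (use \<open>1 < \<tau>\<close> in \<open>auto simp: \<F>_def less_imp_le\<close>)
    have \<F>: "S \<in> admissible \<S> \<mu> \<zeta>" "S \<subseteq> V" "ediam S < ennreal \<epsilon>" "closed S" "S \<in> carath_sets \<mu>"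
      "ennreal t * \<zeta> S \<le> \<mu> S" "0 < \<mu> S" if "S \<in> \<F>" for S
    proof -
      show S: "S \<in> admissible \<S> \<mu> \<zeta>" "S \<subseteq> V" "ediam S < ennreal \<epsilon>"
        using that by (auto simp: \<F>_def)
      show "closed S" by (rule closed[OF S(1)])
      thus "S \<in> carath_sets \<mu>" using \<mu>(2) borel_closed unfolding borel_regular_def by blast
      show "ennreal t * \<zeta> S \<le> \<mu> S" "0 < \<mu> S"
        using mult_le_of_less_quotient_fun[OF S(1)] that by (auto simp: \<F>_def)
    qed
    note \<G>\<F> = subsetD[OF \<G>(1)]
    have "countable \<G>"
      by (rule countable_disjoint_positive[OF \<mu>(1) \<F>(5)[OF \<G>\<F>] \<G>(2) \<F>(2)[OF \<G>\<F>] \<F>(7)[OF \<G>\<F>] V(3)])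
    then obtain S and J :: "nat set" where "bij_betw S J \<G>" by (rule countableE_bij)
    hence inj: "inj_on S J" and img: "S ` J = \<G>" by (auto simp: bij_betw_def)
    have SJ: "S j \<in> \<G>" "S j \<in> \<F>" if "j \<in> J" for j using that img \<G>\<F> by auto
    define f where "f j = (if j \<in> J then \<zeta> (S j) else 0)" for j
    have "(\<Sum>j. \<mu> (if j \<in> J then S j else {})) \<le> \<mu> V"
    proof (rule suminf_disjoint_le[OF \<mu>(1)])
      show "disjoint_family (\<lambda>j. if j \<in> J then S j else {})"
        unfolding disjoint_family_on_def
      proof (intro ballI impI)
        fix i j :: nat assume "i \<noteq> j"
        show "(if i \<in> J then S i else {}) \<inter> (if j \<in> J then S j else {}) = {}"
        proof (cases "i \<in> J \<and> j \<in> J")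
          case True
          hence "S i \<noteq> S j" using \<open>i \<noteq> j\<close> inj by (auto dest: inj_onD)
          thus ?thesis using True SJ(1) \<G>(2) by (simp add: disjointD)
        qed auto
      qed
      show "(if j \<in> J then S j else {}) \<in> carath_sets \<mu>" for j
        using \<F>(5)[OF SJ(2)] null_carath_sets[OF \<mu>(1) outer_measure_zero[OF \<mu>(1)]] by simp
      show "(if j \<in> J then S j else {}) \<subseteq> V" for j
        using \<F>(2)[OF SJ(2)] by simp
    qed
    moreover have "ennreal t * (\<Sum>j. f j) \<le> (\<Sum>j. \<mu> (if j \<in> J then S j else {}))"
      unfolding ennreal_suminf_cmult[symmetric]
      by (intro suminf_le summableI allI) (auto simp: f_def \<F>(6)[OF SJ(2)])
    ultimately have sum_f: "ennreal t * (\<Sum>j. f j) \<le> \<mu> V" by simp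
    hence "ennreal t * (\<Sum>j. f j) < \<infinity>" using V(3) by (rule le_less_trans)
    hence "(\<Sum>j. f j) < \<infinity>"
      using \<open>0 < t\<close> by (auto simp: ennreal_mult_less_top)
    hence fin: "(\<Sum>j. ennreal \<eta> * f j) < \<infinity>"
      by (simp add: ennreal_mult_less_top)
    have "\<forall>j. \<exists>S'. j \<in> J \<longrightarrow> S' \<in> \<S> \<and> enlargement \<S> \<mu> \<zeta> \<tau> (S j) \<subseteq> S' \<and>
        ediam S' \<le> ennreal c * ediam (S j) \<and> \<zeta> S' \<le> ennreal \<eta> * \<zeta> (S j)"
      using encl[OF \<F>(1)[OF SJ(2)]] by blast
    from choice[OF this] obtain S' where S': "\<And>j. j \<in> J \<Longrightarrow> S' j \<in> \<S>"
      "\<And>j. j \<in> J \<Longrightarrow> enlargement \<S> \<mu> \<zeta> \<tau> (S j) \<subseteq> S' j"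
      "\<And>j. j \<in> J \<Longrightarrow> ediam (S' j) \<le> ennreal c * ediam (S j)"
      "\<And>j. j \<in> J \<Longrightarrow> \<zeta> (S' j) \<le> ennreal \<eta> * \<zeta> (S j)" by blast
    have "carath_approx \<S> \<zeta> \<delta> E \<le> (\<Sum>j. f j)"
    proof (rule le_of_le_add_tails[OF fin])
      fix N
      \<comment> \<open>Only members with index at least \<open>N\<close> are replaced by their
        enclosing sets, so the factor \<open>\<eta>\<close> touches just a tail of the convergent
        series.\<close>
      define C where "C j = (if j < N then S j else S' j)" for j
      have "carath_approx \<S> \<zeta> \<delta> E \<le> (\<Sum>j. if j \<in> J then \<zeta> (C j) else 0)"
      proof (rule carath_approx_le)
        fix j assume "j \<in> J"
        show "C j \<in> \<S>"
          using S'(1)[OF \<open>j \<in> J\<close>] \<F>(1)[OF SJ(2)[OF \<open>j \<in> J\<close>]] by (simp add: C_def admissible_def)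
        have lt: "ediam (S j) < ennreal \<epsilon>" using \<F>(3)[OF SJ(2)[OF \<open>j \<in> J\<close>]] .
        have "ediam (S' j) \<le> ennreal c * ennreal \<epsilon>"
          using S'(3)[OF \<open>j \<in> J\<close>] lt by (meson less_imp_le mult_left_mono order_trans zero_le)
        also have "\<dots> = ennreal \<delta>"
          using \<open>c * \<epsilon> = \<delta>\<close> \<open>0 < \<epsilon>\<close> \<open>1 \<le> c\<close> by (simp flip: ennreal_mult)
        finally have "ediam (S' j) \<le> ennreal \<delta>" .
        moreover have "ediam (S j) \<le> ennreal \<delta>"
          using lt ennreal_leI[OF \<open>\<epsilon> \<le> \<delta>\<close>] by simp
        ultimately show "ediam (C j) \<le> ennreal \<delta>" by (simp add: C_def)
      next
        show "E \<subseteq> (\<Union>j\<in>J. C j)"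
        proof
          fix x assume "x \<in> E"
          define K where "K = (\<Union>j\<in>J \<inter> {..<N}. S j)"
          show "x \<in> (\<Union>j\<in>J. C j)"
          proof (cases "x \<in> K")
            case True
            thus ?thesis by (auto simp: K_def C_def)
          next
            case False
            \<comment> \<open>A finite union of closed sets leaves room for a ball around
              \<open>x\<close> inside \<open>V - K\<close>. A small high-quotient set
              \<open>T\<close> in that ball belongs to \<open>\<F>\<close>, and the selected set
              assigned to it cannot have index below \<open>N\<close>; its enlargement therefore
              contains \<open>x\<close>.\<close>
            have "closed K" unfolding K_def using \<F>(4)[OF SJ(2)] by (intro closed_UN) auto
            hence "open (V - K)" using V(1) by (rule open_Diff[rotated])
            moreover have "x \<in> V - K" using False \<open>x \<in> E\<close> V(2) by blast
            ultimately obtain r where r: "0 < r" "ball x r \<subseteq> V - K"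
              using openE by blast
            obtain T where T: "T \<in> admissible \<S> \<mu> \<zeta>" "x \<in> T" "ediam T < ennreal (min \<epsilon> r)"
              "ennreal t < quotient_fun \<mu> \<zeta> T"
              using less_federer_densityE[OF F[OF \<open>x \<in> E\<close>], of "min \<epsilon> r"] r(1) \<open>0 < \<epsilon>\<close> by auto
            have le: "ennreal (min \<epsilon> r) \<le> ennreal \<epsilon>" "ennreal (min \<epsilon> r) \<le> ennreal r"
              by (auto intro: ennreal_leI)
            have "T \<subseteq> ball x r"
              using dist_less_of_ediam_less[OF T(2) _ less_le_trans[OF T(3) le(2)]] by auto
            hence TV: "T \<subseteq> V" "T \<inter> K = {}" using r(2) by auto
            hence "T \<in> \<F>" using T less_le_trans[OF T(3) le(1)] by (auto simp: \<F>_def)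
            then obtain j where j: "j \<in> J" "T \<inter> S j \<noteq> {}" "ediam T \<le> ennreal \<tau> * ediam (S j)"
              using \<G>(3) img by blast
            have "\<not> j < N" using j(1,2) TV(2) unfolding K_def by blast
            moreover have "x \<in> enlargement \<S> \<mu> \<zeta> \<tau> (S j)"
              using T(1,2) j(2,3) unfolding enlargement_def by blast
            hence "x \<in> S' j" using S'(2)[OF j(1)] by blast
            ultimately have "x \<in> C j" by (simp add: C_def)
            thus ?thesis using j(1) by blast
          qed
        qed
      qed
      also have "\<dots> = (\<Sum>i. if i + N \<in> J then \<zeta> (C (i + N)) else 0) + (\<Sum>j<N. if j \<in> J then \<zeta> (C j) else 0)"
        by (rule suminf_offset) (rule summableI)
      also have "\<dots> \<le> (\<Sum>i. ennreal \<eta> * f (i + N)) + (\<Sum>j<N. f j)"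
        using S'(4) by (intro add_mono suminf_le summableI allI sum_mono) (auto simp: C_def f_def)
      also have "\<dots> \<le> (\<Sum>i. ennreal \<eta> * f (i + N)) + (\<Sum>j. f j)"
        by (intro add_left_mono sum_le_suminf summableI) auto
      finally show "carath_approx \<S> \<zeta> \<delta> E \<le> (\<Sum>j. f j) + (\<Sum>i. ennreal \<eta> * f (i + N))"
        by (simp add: add.commute)
    qed
    hence "ennreal t * carath_approx \<S> \<zeta> \<delta> E \<le> ennreal t * (\<Sum>j. f j)"
      by (rule mult_left_mono) simp
    thus ?thesis using sum_f by (rule order_trans)
  qed
  show ?thesis
    unfolding carath_psi_def SUP_mult_left_ennreal using approx by (intro SUP_least) auto
qed


section \<open>The integral formula\<close>

lemma ennreal_le_of_le_mult:
  assumes "\<And>t::real. 1 < t \<Longrightarrow> x \<le> ennreal t * y"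
  shows "x \<le> y"
proof (cases y)
  case (real r)
  show ?thesis
  proof (cases "r = 0")
    case True
    thus ?thesis using assms[of 2] real by simp
  next
    case False
    hence "0 < r" using real by simp
    show ?thesis
    proof (rule ennreal_le_epsilon)
      fix e :: real assume "0 < e"
      \<comment> \<open>The factor \<open>1 + e / r\<close> turns multiplicative slack into the
        additive excess \<open>e\<close>.\<close>
      have "x \<le> ennreal (1 + e / r) * ennreal r"
        using assms[of "1 + e / r"] \<open>0 < e\<close> \<open>0 < r\<close> real by simp
      also have "\<dots> = ennreal (r + e)"
        using \<open>0 < e\<close> \<open>0 < r\<close> by (simp add: distrib_right flip: ennreal_mult del: ennreal_plus)
      also have "\<dots> = y + ennreal e"
        using \<open>0 < e\<close> \<open>0 < r\<close> real by simp
      finally show "x \<le> y + ennreal e" .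
    qed
  qed
qed simp

lemma powr_band_exists:
  fixes y :: ennreal
  assumes "1 < t" "y \<noteq> 0" "y \<noteq> \<infinity>"
  shows "\<exists>k::int. ennreal (t powr k) \<le> y \<and> y < ennreal (t powr (real_of_int k + 1))"
proof -
  obtain r where r: "y = ennreal r" "0 < r"
    using assms(2,3) by (cases y) (auto simp: less_le)
  have "t powr \<lfloor>log t r\<rfloor> \<le> r \<and> r < t powr (\<lfloor>log t r\<rfloor> + 1)"
    using floor_log_eq_powr_iff[of r t "\<lfloor>log t r\<rfloor>"] r(2) assms(1) by simp
  thus ?thesis
    using r by (intro exI[of _ "\<lfloor>log t r\<rfloor>"]) (auto simp: ennreal_less_iff ennreal_leI)
qed

text \<open>Decompose along the bands \<open>t powr k \<le> f < t powr (k + 1)\<close> with integer \<open>k\<close>, on which both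
  measures agree with \<open>t powr k * \<Psi>\<close> up to a factor \<open>t\<^sup>2\<close>, and let \<open>t\<close> tend to \<open>1\<close>. Additive bands
  would instead need \<open>\<Psi> B\<close> to be finite.\<close>

lemma emeasure_eq_density_of_level_sets:
  fixes \<Psi> M :: "'a measure"
  assumes f: "f \<in> borel_measurable \<Psi>" and B: "B \<in> sets \<Psi>"
    and sets: "\<And>E. E \<in> sets \<Psi> \<Longrightarrow> E \<subseteq> B \<Longrightarrow> E \<in> sets M"
    and zero: "\<And>E. E \<in> sets \<Psi> \<Longrightarrow> E \<subseteq> B \<Longrightarrow> (\<And>x. x \<in> E \<Longrightarrow> f x = 0) \<Longrightarrow> emeasure M E = 0"
    and infty: "\<And>E. E \<in> sets \<Psi> \<Longrightarrow> E \<subseteq> B \<Longrightarrow> (\<And>x. x \<in> E \<Longrightarrow> f x = \<infinity>) \<Longrightarrow>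
      emeasure \<Psi> E = 0 \<and> emeasure M E = 0"
    and upper: "\<And>E t. E \<in> sets \<Psi> \<Longrightarrow> E \<subseteq> B \<Longrightarrow> 0 < t \<Longrightarrow> (\<And>x. x \<in> E \<Longrightarrow> f x < ennreal t) \<Longrightarrow>
      emeasure M E \<le> ennreal t * emeasure \<Psi> E"
    and lower: "\<And>E t. E \<in> sets \<Psi> \<Longrightarrow> E \<subseteq> B \<Longrightarrow> 0 < t \<Longrightarrow> (\<And>x. x \<in> E \<Longrightarrow> ennreal t < f x) \<Longrightarrow>
      ennreal t * emeasure \<Psi> E \<le> emeasure M E"
  shows "emeasure M B = emeasure (density \<Psi> f) B"
proof -
  let ?N = "density \<Psi> f"
  have part: "B \<inter> f -` X \<in> sets \<Psi>" if "X \<in> sets borel" for X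
  proof -
    have "B \<inter> f -` X = B \<inter> (f -` X \<inter> space \<Psi>)" using sets.sets_into_space[OF B] by blast
    thus ?thesis using measurable_sets[OF f that] B by simp
  qed
  have N_lower: "ennreal s * emeasure \<Psi> E \<le> emeasure ?N E"
    if E: "E \<in> sets \<Psi>" "\<And>x. x \<in> E \<Longrightarrow> ennreal s \<le> f x" for E s
  proof -
    have "ennreal s * emeasure \<Psi> E = (\<integral>\<^sup>+x. ennreal s * indicator E x \<partial>\<Psi>)"
      using E(1) by (simp add: nn_integral_cmult_indicator)
    also have "\<dots> \<le> (\<integral>\<^sup>+x. f x * indicator E x \<partial>\<Psi>)"
      using E(2) by (intro nn_integral_mono) (auto split: split_indicator)
    also have "\<dots> = emeasure ?N E" using f E(1) by (simp add: emeasure_density)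
    finally show ?thesis .
  qed
  have N_upper: "emeasure ?N E \<le> ennreal s * emeasure \<Psi> E"
    if E: "E \<in> sets \<Psi>" "\<And>x. x \<in> E \<Longrightarrow> f x \<le> ennreal s" for E s
  proof -
    have "emeasure ?N E = (\<integral>\<^sup>+x. f x * indicator E x \<partial>\<Psi>)"
      using f E(1) by (simp add: emeasure_density)
    also have "\<dots> \<le> (\<integral>\<^sup>+x. ennreal s * indicator E x \<partial>\<Psi>)"
      using E(2) by (intro nn_integral_mono) (auto split: split_indicator)
    also have "\<dots> = ennreal s * emeasure \<Psi> E"
      using E(1) by (simp add: nn_integral_cmult_indicator)
    finally show ?thesis .
  qed
  have compare: "emeasure M B \<le> ennreal t * emeasure ?N B \<and> emeasure ?N B \<le> ennreal (t * t) * emeasure M B"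
    if "1 < t" for t
  proof -
    \<comment> \<open>The values 0 and \<infinity> belong to no band; both measures vanish on this
      set. The remaining bands are indexed by integers and enumerated through
      \<open>int_decode\<close>.\<close>
    define Z where "Z = B \<inter> f -` {0, \<infinity>}"
    define D where "D n = B \<inter> f -` {ennreal (t powr int_decode n)..<ennreal (t powr (real_of_int (int_decode n) + 1))}" for n
    have D: "D n \<in> sets \<Psi>" "D n \<subseteq> B" for n using part by (auto simp: D_def)
    have "emeasure ?N Z = 0 \<and> emeasure M Z = 0 \<and> Z \<in> sets \<Psi>"
    proof -
      define Z0 Z1 where "Z0 = B \<inter> f -` {0}" and "Z1 = B \<inter> f -` {\<infinity>}"
      have Z01: "Z0 \<in> sets \<Psi>" "Z1 \<in> sets \<Psi>" "Z0 \<subseteq> B" "Z1 \<subseteq> B"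
        "\<And>x. x \<in> Z0 \<Longrightarrow> f x = 0" "\<And>x. x \<in> Z1 \<Longrightarrow> f x = \<infinity>"
        using part by (auto simp: Z0_def Z1_def)
      have "emeasure ?N Z0 \<le> ennreal 0 * emeasure \<Psi> Z0"
        by (rule N_upper[OF Z01(1)]) (simp add: Z01(5))
      hence N0: "Z0 \<in> null_sets ?N" using Z01(1) by (intro null_setsI) auto
      note infty = infty[OF Z01(2,4,6)]
      have N1: "Z1 \<in> null_sets ?N"
        using absolutely_continuousI_density[OF f] null_setsI[of \<Psi> Z1] infty Z01(2)
        unfolding absolutely_continuous_def by blast
      have M0: "Z0 \<in> null_sets M"
        by (rule null_setsI[OF zero[OF Z01(1,3,5)] sets[OF Z01(1,3)]])
      have M1: "Z1 \<in> null_sets M"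
        by (rule null_setsI[OF conjunct2[OF infty] sets[OF Z01(2,4)]])
      have "Z = Z0 \<union> Z1" by (auto simp: Z_def Z0_def Z1_def)
      thus ?thesis
        using null_setsD1[OF null_sets.Un[OF N0 N1]] null_setsD1[OF null_sets.Un[OF M0 M1]] Z01(1,2)
        by simp
    qed
    hence Z: "emeasure ?N Z = 0" "emeasure M Z = 0" "Z \<in> sets \<Psi>" by auto
    have cover: "B = Z \<union> (\<Union>n. D n)"
    proof
      show "B \<subseteq> Z \<union> (\<Union>n. D n)"
      proof
        fix x assume "x \<in> B"
        show "x \<in> Z \<union> (\<Union>n. D n)"
        proof (cases "f x = 0 \<or> f x = \<infinity>")
          case False
          hence "f x \<noteq> 0" "f x \<noteq> \<infinity>" by auto
          from powr_band_exists[OF \<open>1 < t\<close> this]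
          obtain k :: int where "ennreal (t powr k) \<le> f x" "f x < ennreal (t powr (real_of_int k + 1))"
            by (elim exE conjE)
          hence "x \<in> D (int_encode k)" using \<open>x \<in> B\<close> by (simp add: D_def)
          thus ?thesis by blast
        qed (use \<open>x \<in> B\<close> in \<open>auto simp: Z_def\<close>)
      qed
    qed (use D(2) in \<open>auto simp: Z_def\<close>)
    have disj: "disjoint_family D"
      unfolding disjoint_family_on_def
    proof (intro ballI impI equals0I)
      have False if "i < j" and x: "ennreal (t powr i) \<le> f x" "f x < ennreal (t powr (real_of_int i + 1))"
        "ennreal (t powr j) \<le> f x" "f x < ennreal (t powr (real_of_int j + 1))" for i j :: int and x
      proof -
        have "t powr (real_of_int i + 1) \<le> t powr j" using \<open>1 < t\<close> \<open>i < j\<close> by (intro powr_mono) auto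
        hence "ennreal (t powr (real_of_int i + 1)) \<le> ennreal (t powr j)" by (rule ennreal_leI)
        thus False using x by (meson leD less_le_trans order_trans)
      qed
      note * = this
      fix m n x assume "m \<noteq> n" and x: "x \<in> D m \<inter> D n"
      hence "int_decode m \<noteq> int_decode n" by (simp add: inj_eq[OF inj_int_decode])
      hence "int_decode m < int_decode n \<or> int_decode n < int_decode m" by linarith
      thus False using x *[of "int_decode m" "int_decode n" x] *[of "int_decode n" "int_decode m" x]
        by (auto simp: D_def)
    qed
    have decomp: "emeasure L B = (\<Sum>n. emeasure L (D n))"
      if "\<And>E. E \<in> sets \<Psi> \<Longrightarrow> E \<subseteq> B \<Longrightarrow> E \<in> sets L" "emeasure L Z = 0" for L
    proof -
      have DL: "range D \<subseteq> sets L" using D that(1) by blast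
      have "Z \<in> sets L" using Z(3) that(1) by (auto simp: Z_def)
      hence "emeasure L B = emeasure L (\<Union>n. D n)"
        using emeasure_Un_null_set[of "\<Union>n. D n" L Z] sets.countable_UN[OF DL] that(2) cover
        by (simp add: null_sets_def Un_commute)
      thus ?thesis using suminf_emeasure[OF DL disj] by simp
    qed
    have M_D: "emeasure M (D n) \<le> ennreal t * emeasure ?N (D n)" for n
    proof -
      let ?s = "t powr int_decode n"
      have s: "t powr (real_of_int (int_decode n) + 1) = t * ?s" using \<open>1 < t\<close> by (simp add: powr_add)
      have "emeasure M (D n) \<le> ennreal (t * ?s) * emeasure \<Psi> (D n)"
        using \<open>1 < t\<close> by (intro upper[OF D]) (auto simp: D_def s)
      also have "\<dots> = ennreal t * (ennreal ?s * emeasure \<Psi> (D n))"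
        using \<open>1 < t\<close> by (simp add: ennreal_mult mult.assoc)
      also have "\<dots> \<le> ennreal t * emeasure ?N (D n)"
        by (intro mult_left_mono N_lower[OF D(1)]) (auto simp: D_def)
      finally show ?thesis .
    qed
    have N_D: "emeasure ?N (D n) \<le> ennreal (t * t) * emeasure M (D n)" for n
    proof -
      \<comment> \<open>The hypothesis \<open>lower\<close> requires a strict bound, but the band
        gives only \<open>t powr k \<le> f x\<close>. Stepping down one more power restores
        strictness and costs the second factor \<open>t\<close>.\<close>
      let ?s = "t powr (real_of_int (int_decode n) - 1)"
      have s: "t powr (real_of_int (int_decode n) + 1) = t * t * ?s" "t powr int_decode n = t * ?s"
        using \<open>1 < t\<close> by (simp_all add: powr_add powr_diff)
      have "emeasure ?N (D n) \<le> ennreal (t * t * ?s) * emeasure \<Psi> (D n)"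
        by (intro N_upper[OF D(1)]) (auto simp: D_def s less_imp_le)
      also have "\<dots> = ennreal (t * t) * (ennreal ?s * emeasure \<Psi> (D n))"
        using \<open>1 < t\<close> by (simp add: ennreal_mult mult.assoc)
      also have "\<dots> \<le> ennreal (t * t) * emeasure M (D n)"
      proof (intro mult_left_mono lower[OF D])
        fix x assume "x \<in> D n"
        have "ennreal ?s < ennreal (t powr int_decode n)"
          using \<open>1 < t\<close> by (simp add: ennreal_less_iff powr_less_mono)
        also have "\<dots> \<le> f x" using \<open>x \<in> D n\<close> by (simp add: D_def)
        finally show "ennreal ?s < f x" .
      qed (use \<open>1 < t\<close> in auto)
      finally show ?thesis .
    qed
    have "emeasure M B = (\<Sum>n. emeasure M (D n))"
      using sets Z(2) by (rule decomp)
    moreover have "emeasure ?N B = (\<Sum>n. emeasure ?N (D n))"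
      using Z(1) by (intro decomp) auto
    moreover have "(\<Sum>n. emeasure M (D n)) \<le> ennreal t * (\<Sum>n. emeasure ?N (D n))"
      unfolding ennreal_suminf_cmult[symmetric] by (intro suminf_le summableI allI M_D)
    moreover have "(\<Sum>n. emeasure ?N (D n)) \<le> ennreal (t * t) * (\<Sum>n. emeasure M (D n))"
      unfolding ennreal_suminf_cmult[symmetric] by (intro suminf_le summableI allI N_D)
    ultimately show ?thesis by simp
  qed
  show ?thesis
  proof (rule antisym)
    show "emeasure M B \<le> emeasure ?N B"
      by (rule ennreal_le_of_le_mult) (simp add: compare)
    show "emeasure ?N B \<le> emeasure M B"
    proof (rule ennreal_le_of_le_mult)
      fix t :: real assume "1 < t"
      thus "emeasure ?N B \<le> ennreal t * emeasure M B"
        \<comment> \<open>Applying the comparison at \<open>sqrt t\<close> reduces the squared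
          factor to \<open>t\<close>.\<close>
        using compare[of "sqrt t"] by simp
    qed
  qed
qed

section \<open>Transfer of measurability and assembly of the integral formula\<close>

lemma carath_sets_of_abs_cont:
  assumes \<mu>: "measure_over \<mu>" "borel_regular \<mu>" and \<psi>: "measure_over \<psi>" "borel_regular \<psi>"
    and "abs_cont_on \<mu> \<psi> A" "sigma_finite_set \<psi> A" "B \<subseteq> A" "B \<in> carath_sets \<psi>"
  shows "B \<in> carath_sets \<mu>"
proof -
  have "sigma_finite_set \<psi> B"
    using assms(6,7) unfolding sigma_finite_set_def by (meson order_trans)
  then obtain K where K: "K \<in> sets borel" "K \<subseteq> B" "\<psi> (B - K) = 0"
    using borel_inner_approx[OF \<psi> assms(8)] by blast
  moreover have "B - K \<subseteq> A" using \<open>B \<subseteq> A\<close> by blast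
  ultimately have "\<mu> (B - K) = 0" using assms(5) unfolding abs_cont_on_def by blast
  hence "B - K \<in> carath_sets \<mu>" by (rule null_carath_sets[OF \<mu>(1)])
  moreover have "K \<in> carath_sets \<mu>" using K(1) \<mu>(2) unfolding borel_regular_def by blast
  ultimately have "K \<union> (B - K) \<in> carath_sets \<mu>"
    by (metis sets.Un sets_carath_measure[OF \<mu>(1)])
  moreover have "K \<union> (B - K) = B" using K(2) by blast
  ultimately show ?thesis by simp
qed

theorem theorem4p2:
  fixes \<mu> \<zeta> :: "'a::metric_space set \<Rightarrow> ennreal"
    and \<S> :: "'a set set"
    and \<tau> :: real
    and A :: "'a set"
  assumes "measure_over \<mu>"
    and "\<S> \<noteq> {}"
    and "\<tau> > 1"
    and "A \<noteq> {}"
    and "borel_regular \<mu>"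
    and "\<forall>S\<in>\<S>. S \<in> sets borel"
    and "\<forall>S\<in>admissible \<S> \<mu> \<zeta>. closed S"
    and "covers_finely (admissible \<S> \<mu> \<zeta>) A"
    and "A \<in> carath_sets (carath_psi \<S> \<zeta>)"
    and "sigma_finite_set (carath_psi \<S> \<zeta>) A"
    and "\<exists>\<U>. countable \<U> \<and> A \<subseteq> \<Union>\<U> \<and> (\<forall>U\<in>\<U>. open U \<and> \<mu> U < \<infinity>)"
    and "\<exists>c \<eta> :: real. c \<ge> 1 \<and> \<eta> > 0 \<and>
           (\<forall>S\<in>admissible \<S> \<mu> \<zeta>. \<exists>S'\<in>\<S>.
              enlargement \<S> \<mu> \<zeta> \<tau> S \<subseteq> S' \<and>
              ediam S' \<le> ennreal c * ediam S \<and>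
              \<zeta> S' \<le> ennreal \<eta> * \<zeta> S)"
    and "abs_cont_on \<mu> (carath_psi \<S> \<zeta>) A"
    and "federer_density \<S> \<zeta> \<mu>
           \<in> borel_measurable (restrict_space (carath_measure (carath_psi \<S> \<zeta>)) A)"
  shows "\<forall>B\<subseteq>A. B \<in> carath_sets (carath_psi \<S> \<zeta>) \<longrightarrow>
           B \<in> carath_sets \<mu> \<and>
           \<mu> B = (\<integral>\<^sup>+x\<in>B. federer_density \<S> \<zeta> \<mu> x \<partial>carath_measure (carath_psi \<S> \<zeta>))"
proof (intro allI impI conjI)
  fix B assume B: "B \<subseteq> A" "B \<in> carath_sets (carath_psi \<S> \<zeta>)"
  note \<mu> = assms(1,5)
  define \<psi> where "\<psi> = carath_psi \<S> \<zeta>"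
  define F where "F = federer_density \<S> \<zeta> \<mu>"
  have \<psi>: "measure_over \<psi>" "borel_regular \<psi>"
    unfolding \<psi>_def by (rule measure_over_carath_psi, rule borel_regular_carath_psi[OF assms(6)])
  note [simp] = sets_carath_measure[OF \<mu>(1)] sets_carath_measure[OF \<psi>(1)]
    emeasure_carath_measure[OF \<mu>(1)] emeasure_carath_measure[OF \<psi>(1)]
  have meas: "E \<in> carath_sets \<mu>" if "E \<subseteq> A" "E \<in> carath_sets \<psi>" for E
    using carath_sets_of_abs_cont[OF \<mu> \<psi>] assms(10,13) that unfolding \<psi>_def by blast
  show "B \<in> carath_sets \<mu>" using meas B by (simp add: \<psi>_def)

  have upper: "\<mu> E \<le> ennreal t * \<psi> E" if "0 < t" "\<And>x. x \<in> E \<Longrightarrow> F x < ennreal t" for E t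
    using measure_le_of_federer_density_less[OF \<mu> that(1)] that(2) unfolding F_def \<psi>_def by blast

  obtain c \<eta> :: real where c: "1 \<le> c" "0 < \<eta>"
    and encl: "\<And>S. S \<in> admissible \<S> \<mu> \<zeta> \<Longrightarrow> \<exists>S'\<in>\<S>. enlargement \<S> \<mu> \<zeta> \<tau> S \<subseteq> S' \<and>
              ediam S' \<le> ennreal c * ediam S \<and> \<zeta> S' \<le> ennreal \<eta> * \<zeta> S"
    using assms(12) by blast
  have lower_open: "ennreal t * \<psi> E \<le> \<mu> V"
    if "open V" "E \<subseteq> V" "\<mu> V < \<infinity>" "0 < t" "\<And>x. x \<in> E \<Longrightarrow> ennreal t < F x" for E V t
    unfolding \<psi>_def
    by (rule mult_psi_le_open_of_less_federer_density[OF \<mu> _ assms(3) c encl])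
      (use assms(7) that in \<open>auto simp: F_def\<close>)
  obtain \<U> where "countable \<U>" "A \<subseteq> \<Union>\<U>" "\<forall>U\<in>\<U>. open U \<and> \<mu> U < \<infinity>"
    using assms(11) by blast
  from countable_cover_sequence[OF this] obtain U
    where U: "\<And>n::nat. open (U n)" "\<And>n. \<mu> (U n) < \<infinity>" "A \<subseteq> (\<Union>n. U n)"
    using outer_measure_zero[OF \<mu>(1)] by auto
  have lower: "ennreal t * \<psi> E \<le> \<mu> E"
    if "E \<subseteq> A" "0 < t" "\<And>x. x \<in> E \<Longrightarrow> ennreal t < F x" for E t
  proof (rule ennreal_le_epsilon)
    fix e :: real assume "0 < e" "\<mu> E < top"
    have "E \<subseteq> (\<Union>n. U n)" using \<open>E \<subseteq> A\<close> U(3) by blast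
    from open_outer_approx[OF \<mu> U(1,2) this \<open>0 < e\<close>]
    obtain V where V: "open V" "E \<subseteq> V" "\<mu> V \<le> \<mu> E + ennreal e" by (elim exE conjE)
    have "\<mu> V < \<infinity>" using V(3) \<open>\<mu> E < top\<close> by (auto intro: le_less_trans)
    hence "ennreal t * \<psi> E \<le> \<mu> V" using that(2,3) by (intro lower_open[OF V(1,2)])
    thus "ennreal t * \<psi> E \<le> \<mu> E + ennreal e" using V(3) by (rule order_trans)
  qed

  have zero: "\<mu> E = 0" if "E \<subseteq> A" "\<And>x. x \<in> E \<Longrightarrow> F x = 0" for E
  proof -
    obtain \<C> where "countable \<C>" "A \<subseteq> \<Union>\<C>" "\<forall>C\<in>\<C>. \<psi> C < \<infinity>"
      using assms(10) unfolding sigma_finite_set_def \<psi>_def by blast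
    from countable_cover_sequence[OF this] obtain C
      where C: "A \<subseteq> (\<Union>n. C n)" "\<And>n::nat. \<psi> (C n) < \<infinity>"
      using outer_measure_zero[OF \<psi>(1)] by auto
    have "\<mu> (E \<inter> C n) = 0" for n
    proof -
      have fin: "\<psi> (E \<inter> C n) < \<infinity>"
        using outer_measure_mono[OF \<psi>(1), of "E \<inter> C n" "C n"] C(2)[of n] by (auto intro: le_less_trans)
      have le: "\<mu> (E \<inter> C n) \<le> ennreal t * \<psi> (E \<inter> C n)" if "0 < t" for t
        using upper[OF that, of "E \<inter> C n"] \<open>\<And>x. x \<in> E \<Longrightarrow> F x = 0\<close> that by auto
      show ?thesis
      proof (cases "\<psi> (E \<inter> C n)")
        case (real r)
        have "\<mu> (E \<inter> C n) \<le> 0"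
        proof (rule ennreal_le_epsilon)
          fix e :: real assume "0 < e"
          \<comment> \<open>The denominator \<open>r + 1\<close> is positive even when the piece is
            \<open>\<psi>\<close>-null, and the product stays below \<open>e\<close>.\<close>
          have "\<mu> (E \<inter> C n) \<le> ennreal (e / (r + 1)) * ennreal r"
            using le[of "e / (r + 1)"] \<open>0 < e\<close> real by simp
          also have "\<dots> = ennreal (e / (r + 1) * r)"
            using \<open>0 < e\<close> real by (intro ennreal_mult[symmetric]) auto
          also have "\<dots> \<le> ennreal e"
            using \<open>0 < e\<close> real by (intro ennreal_leI) (simp add: field_simps)
          finally show "\<mu> (E \<inter> C n) \<le> 0 + ennreal e" by simp
        qed
        thus ?thesis by simp
      qed (use fin in simp)
    qed
    hence "\<mu> (\<Union>n. E \<inter> C n) = 0" by (rule outer_measure_UN_null[OF \<mu>(1)])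
    moreover have "E = (\<Union>n. E \<inter> C n)" using \<open>E \<subseteq> A\<close> C(1) by blast
    ultimately show ?thesis by simp
  qed

  have infty: "\<psi> E = 0 \<and> \<mu> E = 0" if "E \<subseteq> A" "\<And>x. x \<in> E \<Longrightarrow> F x = \<infinity>" for E
  proof -
    have "\<psi> (E \<inter> U n) = 0" for n
    proof -
      have le: "ennreal t * \<psi> (E \<inter> U n) \<le> \<mu> (U n)" if "0 < t" for t
        using lower_open[OF U(1) _ U(2) that, of "E \<inter> U n" n] \<open>\<And>x. x \<in> E \<Longrightarrow> F x = \<infinity>\<close> by auto
      obtain m where m: "\<mu> (U n) = ennreal m" "0 \<le> m"
        using U(2)[of n] by (cases "\<mu> (U n)") auto
      show ?thesis
      proof (cases "\<psi> (E \<inter> U n)")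
        case (real r)
        show ?thesis
        proof (rule ccontr)
          assume "\<psi> (E \<inter> U n) \<noteq> 0"
          hence "0 < r" using real by (simp add: less_le)
          \<comment> \<open>If \<open>r > 0\<close>, the level \<open>t = (m + 1) / r\<close> would
            force \<open>\<mu> (U n)\<close> to be at least \<open>m + 1\<close>, although it equals
            \<open>m\<close>.\<close>
          have "ennreal (m + 1) = ennreal ((m + 1) / r) * ennreal r"
            using \<open>0 < r\<close> m(2) by (simp flip: ennreal_mult del: ennreal_plus)
          also have "\<dots> \<le> ennreal m"
            using le[of "(m + 1) / r"] \<open>0 < r\<close> m real by simp
          finally show False using m(2) by (simp del: ennreal_plus)
        qed
      next
        case top
        thus ?thesis using le[of 1] m by (simp add: top_unique)
      qed
    qed
    hence "\<psi> (\<Union>n. E \<inter> U n) = 0" by (rule outer_measure_UN_null[OF \<psi>(1)])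
    moreover have "E = (\<Union>n. E \<inter> U n)" using \<open>E \<subseteq> A\<close> U(3) by blast
    ultimately have "\<psi> E = 0" by simp
    thus ?thesis using assms(13) \<open>E \<subseteq> A\<close> unfolding abs_cont_on_def \<psi>_def by blast
  qed

  \<comment> \<open>Measurability of the density is assumed on \<open>A\<close> alone; as
    \<open>A\<close> is \<open>\<psi>\<close>-measurable, extension by 0 gives a function measurable
    on the whole space that agrees with \<open>F\<close> on every subset of
    \<open>A\<close>.\<close>
  let ?\<Psi> = "carath_measure \<psi>" and ?f = "\<lambda>x. F x * indicator A x"
  have f: "?f \<in> borel_measurable ?\<Psi>"
    using assms(9,14) unfolding F_def \<psi>_def[symmetric]
    by (subst borel_measurable_restrict_space_iff_ennreal[symmetric]) auto
  have "B \<in> carath_sets \<psi>" using B(2) by (simp add: \<psi>_def)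
  hence "B \<in> sets ?\<Psi>" by simp
  have "emeasure (carath_measure \<mu>) B = emeasure (density ?\<Psi> ?f) B"
  proof (rule emeasure_eq_density_of_level_sets[OF f \<open>B \<in> sets ?\<Psi>\<close>])
    fix E assume E: "E \<in> sets ?\<Psi>" "E \<subseteq> B"
    hence EA: "E \<subseteq> A" "E \<in> carath_sets \<psi>" using B(1) by auto
    have fF: "?f x = F x" if "x \<in> E" for x using that EA(1) by auto
    show "E \<in> sets (carath_measure \<mu>)" using meas[OF EA] by simp
    show "emeasure (carath_measure \<mu>) E = 0" if "\<And>x. x \<in> E \<Longrightarrow> ?f x = 0"
      using zero[OF EA(1)] that fF meas[OF EA] by auto
    show "emeasure ?\<Psi> E = 0 \<and> emeasure (carath_measure \<mu>) E = 0" if "\<And>x. x \<in> E \<Longrightarrow> ?f x = \<infinity>"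
      using infty[OF EA(1)] that fF meas[OF EA] EA(2) by auto
    show "emeasure (carath_measure \<mu>) E \<le> ennreal t * emeasure ?\<Psi> E"
      if "0 < t" "\<And>x. x \<in> E \<Longrightarrow> ?f x < ennreal t" for t
      using upper[OF that(1)] that(2) fF meas[OF EA] EA(2) by auto
    show "ennreal t * emeasure ?\<Psi> E \<le> emeasure (carath_measure \<mu>) E"
      if "0 < t" "\<And>x. x \<in> E \<Longrightarrow> ennreal t < ?f x" for t
      using lower[OF EA(1) that(1)] that(2) fF meas[OF EA] EA(2) by auto
  qed
  also have "\<dots> = (\<integral>\<^sup>+x. ?f x * indicator B x \<partial>?\<Psi>)"
    using f \<open>B \<in> sets ?\<Psi>\<close> by (rule emeasure_density)
  also have "\<dots> = (\<integral>\<^sup>+x\<in>B. F x \<partial>?\<Psi>)"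
    using B(1) by (intro nn_integral_cong) (auto split: split_indicator)
  finally show "\<mu> B = (\<integral>\<^sup>+x\<in>B. federer_density \<S> \<zeta> \<mu> x \<partial>carath_measure (carath_psi \<S> \<zeta>))"
    using meas[OF B(1) \<open>B \<in> carath_sets \<psi>\<close>] by (simp add: F_def \<psi>_def)
qed

end
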